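(* There exists a randomized algorithm that, given any $n\times n$ doubly-stochastic matrix $M$ with $m$ non-zero entries, finds a perfect matching in the support of $M$ in $O(n\log^2 n)$ expected time, after $O(m)$ preprocessing time.
   Context: A doubly-stochastic matrix is a square matrix with nonnegative real entries whose rows and columns all sum to $1$. The support of $M$ is the bipartite graph with parts the rows and the columns of $M$, in which row $i$ and column $j$ are adjacent iff $M_{ij}\neq 0$; a perfect matching in the support is a permutation $\sigma$ of $\{1,\dots,n\}$ with $M_{i\sigma(i)}\ne 0$ for all $i$. The matrix is given in sparse form as the weighted support graph in adjacency array format: for each vertex (row or column), the list of its neighbors with the corresponding non-zero entries is stored in an array, with no assumption on the order within an array. Time is measured in the unit-cost random access machine model, where arithmetic operations and comparisons on matrix entries, and drawing a uniformly random number from an interval, take constant time. The expectation is over the internal randomness of the algorithm, for a worst-case input; the constants implied by $O(\cdot)$ are absolute. *)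

theory Defs
  imports
    "HOL-Probability.Probability"
    "Jordan_Normal_Form.Matrix"
begin

definition doubly_stochastic :: "nat \<Rightarrow> real mat \<Rightarrow> bool" where
  "doubly_stochastic n M \<longleftrightarrow>
     M \<in> carrier_mat n n \<and>
     (\<forall>i<n. \<forall>j<n. 0 \<le> M $$ (i, j)) \<and>
     (\<forall>i<n. (\<Sum>j<n. M $$ (i, j)) = 1) \<and>
     (\<forall>j<n. (\<Sum>i<n. M $$ (i, j)) = 1)"

definition support :: "nat \<Rightarrow> real mat \<Rightarrow> (nat \<times> nat) set" where
  "support n M = {(i, j). i < n \<and> j < n \<and> M $$ (i, j) \<noteq> 0}"

definition perfect_matching :: "nat \<Rightarrow> real mat \<Rightarrow> (nat \<Rightarrow> nat) \<Rightarrow> bool" where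
  "perfect_matching n M \<sigma> \<longleftrightarrow>
     \<sigma> permutes {..<n} \<and> (\<forall>i<n. (i, \<sigma> i) \<in> support n M)"

text \<open>
  The memory consists of arrays of natural numbers (used for addresses and counters) and arrays of
  real numbers, all unbounded. A scalar variable is cell 0 of an array. Array names
  are literals of the program, so a program uses only finitely many arrays; interleaving them
  yields an ordinary random access memory with a constant number of operations per access.
\<close>

type_synonym name = string

record memory =
  nats :: "name \<Rightarrow> nat \<Rightarrow> nat"
  reals :: "name \<Rightarrow> nat \<Rightarrow> real"

text \<open>
  Natural numbers are only added, subtracted (with truncation at 0) and halved. There are no real
  literals, which could hide an unbounded amount of advice in a program, and no rounding of reals
  to natural numbers, which would give constant-time access to the digits of a real.
\<close>

datatype nexp =
    Lit nat
  | Nat_Cell name nexp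
  | Add nexp nexp
  | Sub nexp nexp
  | Half nexp

datatype rexp =
    Of_Nat nexp
  | Real_Cell name nexp
  | RAdd rexp rexp
  | RSub rexp rexp
  | RMult rexp rexp
  | RDiv rexp rexp

datatype bexp =
    Less nexp nexp
  | RLess rexp rexp
  | Neg bexp
  | Conj bexp bexp

datatype com =
    SKIP
  | Nat_Assign name nexp nexp
  | Real_Assign name nexp rexp
  | Nat_Draw name nexp nexp
  | Real_Draw name nexp rexp rexp
  | Seq com com
  | If bexp com com
  | While bexp com

fun nval :: "nexp \<Rightarrow> memory \<Rightarrow> nat" where
  "nval (Lit k) s = k"
| "nval (Nat_Cell a e) s = nats s a (nval e s)"
| "nval (Add e f) s = nval e s + nval f s"
| "nval (Sub e f) s = nval e s - nval f s"
| "nval (Half e) s = nval e s div 2"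

fun rval :: "rexp \<Rightarrow> memory \<Rightarrow> real" where
  "rval (Of_Nat e) s = real (nval e s)"
| "rval (Real_Cell a e) s = reals s a (nval e s)"
| "rval (RAdd x y) s = rval x s + rval y s"
| "rval (RSub x y) s = rval x s - rval y s"
| "rval (RMult x y) s = rval x s * rval y s"
| "rval (RDiv x y) s = rval x s / rval y s"

fun bval :: "bexp \<Rightarrow> memory \<Rightarrow> bool" where
  "bval (Less e f) s \<longleftrightarrow> nval e s < nval f s"
| "bval (RLess x y) s \<longleftrightarrow> rval x s < rval y s"
| "bval (Neg b) s \<longleftrightarrow> \<not> bval b s"
| "bval (Conj b c) s \<longleftrightarrow> bval b s \<and> bval c s"

definition set_nat :: "name \<Rightarrow> nat \<Rightarrow> nat \<Rightarrow> memory \<Rightarrow> memory" where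
  "set_nat a i k s = s\<lparr>nats := (nats s)(a := (nats s a)(i := k))\<rparr>"

definition set_real :: "name \<Rightarrow> nat \<Rightarrow> real \<Rightarrow> memory \<Rightarrow> memory" where
  "set_real a i x s = s\<lparr>reals := (reals s)(a := (reals s a)(i := x))\<rparr>"

text \<open>
  A configuration pairs the memory with the stream of random numbers in \<open>[0,1)\<close> not drawn so far.
  \<open>exec c x t y\<close> means that \<open>c\<close>, started in \<open>x\<close>, terminates in \<open>y\<close> after \<open>t\<close> steps. Every
  assignment, draw and test is one step: an expression of a fixed program has constant size, so
  charging for its operations separately would change the time by a constant factor only.
  \<open>Nat_Draw a i k\<close> draws uniformly from \<open>{0..<k}\<close>, and \<open>Real_Draw a i l h\<close> from \<open>[l,h)\<close>.
\<close>

type_synonym config = "memory \<times> real stream"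

inductive exec :: "com \<Rightarrow> config \<Rightarrow> nat \<Rightarrow> config \<Rightarrow> bool" where
  Skip: "exec SKIP x 0 x"
| Nat_Assign:
    "exec (Nat_Assign a i e) (s, \<omega>) 1 (set_nat a (nval i s) (nval e s) s, \<omega>)"
| Real_Assign:
    "exec (Real_Assign a i e) (s, \<omega>) 1 (set_real a (nval i s) (rval e s) s, \<omega>)"
| Nat_Draw:
    "exec (Nat_Draw a i k) (s, \<omega>) 1
       (set_nat a (nval i s) (nat \<lfloor>shd \<omega> * real (nval k s)\<rfloor>) s, stl \<omega>)"
| Real_Draw:
    "exec (Real_Draw a i l h) (s, \<omega>) 1
       (set_real a (nval i s) (rval l s + shd \<omega> * (rval h s - rval l s)) s, stl \<omega>)"
| Seq: "exec c x t y \<Longrightarrow> exec d y u z \<Longrightarrow> exec (Seq c d) x (t + u) z"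
| If_True: "bval b (fst x) \<Longrightarrow> exec c x t y \<Longrightarrow> exec (If b c d) x (1 + t) y"
| If_False: "\<not> bval b (fst x) \<Longrightarrow> exec d x t y \<Longrightarrow> exec (If b c d) x (1 + t) y"
| While_False: "\<not> bval b (fst x) \<Longrightarrow> exec (While b c) x 1 x"
| While_True:
    "bval b (fst x) \<Longrightarrow> exec c x t y \<Longrightarrow> exec (While b c) y u z \<Longrightarrow>
     exec (While b c) x (1 + t + u) z"

definition coins :: "real stream measure" where
  "coins = stream_space (uniform_measure lborel {0..<1})"

definition halts_within :: "real \<Rightarrow> com \<Rightarrow> config \<Rightarrow> bool" where
  "halts_within B c x \<longleftrightarrow> (\<exists>t y. exec c x t y \<and> real t \<le> B)"

definition run :: "com \<Rightarrow> config \<Rightarrow> config" where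
  "run c x = (THE y. \<exists>t. exec c x t y)"

text \<open>The running time is \<open>\<infinity>\<close>, as the infimum of the empty set, if the program does not halt.\<close>

definition time :: "com \<Rightarrow> config \<Rightarrow> ennreal" where
  "time c x = (INF t\<in>{t. \<exists>y. exec c x t y}. of_nat t)"

text \<open>
  The list of vertex \<open>v\<close> occupies the cells \<open>p, \<dots>, p + d - 1\<close> of the arrays \<open>adj\<close>, where \<open>p\<close> and \<open>d\<close>
  are the entries at \<open>v\<close> of the arrays \<open>first\<close> and \<open>deg\<close>: the array of naturals called \<open>adj\<close> holds
  the neighbours, in any order, and the array of reals called \<open>adj\<close> holds the entries of the matrix.
\<close>

definition adjacency_arrays ::
    "memory \<Rightarrow> name \<Rightarrow> name \<Rightarrow> name \<Rightarrow> nat \<Rightarrow> (nat \<Rightarrow> nat \<Rightarrow> real) \<Rightarrow> bool" where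
  "adjacency_arrays s first deg adj n w \<longleftrightarrow>
     (\<forall>v<n. let p = nats s first v; d = nats s deg v in
        bij_betw (\<lambda>k. nats s adj (p + k)) {..<d} {u. u < n \<and> w v u \<noteq> 0} \<and>
        (\<forall>k<d. reals s adj (p + k) = w v (nats s adj (p + k))))"

text \<open>All other cells may hold arbitrary values when the program starts.\<close>

definition sparse_input :: "nat \<Rightarrow> real mat \<Rightarrow> memory \<Rightarrow> bool" where
  "sparse_input n M s \<longleftrightarrow>
     nats s ''n'' 0 = n \<and>
     adjacency_arrays s ''row_first'' ''row_deg'' ''row_adj'' n (\<lambda>i j. M $$ (i, j)) \<and>
     adjacency_arrays s ''col_first'' ''col_deg'' ''col_adj'' n (\<lambda>j i. M $$ (i, j))"

definition matching_output :: "nat \<Rightarrow> real mat \<Rightarrow> memory \<Rightarrow> bool" where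
  "matching_output n M s \<longleftrightarrow>
     (\<exists>\<sigma>. perfect_matching n M \<sigma> \<and> (\<forall>i<n. nats s ''matching'' i = \<sigma> i))"

text \<open>
  Executions are deterministic given the stream, so \<open>run\<close> and \<open>time\<close> are the final configuration
  and the number of steps, and the running time is measurable for every pair of programs, so its
  Lebesgue integral with respect to \<open>coins\<close> is its expectation.
\<close>

lemma exec_deterministic:
  "exec c x t y \<Longrightarrow> exec c x u z \<Longrightarrow> t = u \<and> y = z"
proof (induction arbitrary: u z rule: exec.induct)
  case (Seq c x t y d u' z')
  from Seq.prems obtain t1 y1 u1 where "exec c x t1 y1" "exec d y1 u1 z" "u = t1 + u1"
    by (auto elim: exec.cases)
  then show ?case using Seq.IH by blast
next
  case (While_True b x c t y u' z')
  from While_True.prems While_True.hyps(1) obtain t1 y1 u1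
    where "exec c x t1 y1" "exec (While b c) y1 u1 z" "u = 1 + t1 + u1"
    by (auto elim: exec.cases)
  then show ?case using While_True.IH by blast
next
  case (If_True b x c t y d)
  from If_True.prems If_True.hyps(1) obtain t1 where "exec c x t1 z" "u = 1 + t1"
    by (auto elim: exec.cases)
  then show ?case using If_True.IH by blast
next
  case (If_False b x d t y c)
  from If_False.prems If_False.hyps(1) obtain t1 where "exec d x t1 z" "u = 1 + t1"
    by (auto elim: exec.cases)
  then show ?case using If_False.IH by blast
qed (auto elim: exec.cases)

lemma run_eq: "exec c x t y \<Longrightarrow> run c x = y"
  unfolding run_def using exec_deterministic by blast

lemma time_eq: "exec c x t y \<Longrightarrow> time c x = of_nat t"
proof -
  assume a: "exec c x t y"
  then have "{t. \<exists>y. exec c x t y} = {t}" using exec_deterministic by blast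
  then show ?thesis by (simp add: time_def)
qed

definition config_space :: "config measure" where
  "config_space = vimage_algebra UNIV
     (\<lambda>(s, \<omega>). ((\<lambda>p. nats s (fst p) (snd p), \<lambda>p. reals s (fst p) (snd p)), \<omega>))
     (((\<Pi>\<^sub>M p\<in>UNIV. count_space UNIV) \<Otimes>\<^sub>M (\<Pi>\<^sub>M p\<in>UNIV. borel)) \<Otimes>\<^sub>M stream_space borel)"

lemma space_config_space [simp]: "space config_space = UNIV"
  by (simp add: config_space_def)

lemma config_coordinates:
  shows "(\<lambda>x. nats (fst x) a i) \<in> measurable config_space (count_space UNIV)"
    and "(\<lambda>x. reals (fst x) a i) \<in> borel_measurable config_space"
    and "snd \<in> measurable config_space (stream_space borel)"
proof -
  let ?f = "\<lambda>(s, \<omega>). ((\<lambda>p. nats s (fst p) (snd p), \<lambda>p. reals s (fst p) (snd p)), \<omega> :: real stream)"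
  let ?N = "(\<Pi>\<^sub>M p\<in>UNIV. count_space UNIV) :: (name \<times> nat \<Rightarrow> nat) measure"
  let ?R = "(\<Pi>\<^sub>M p\<in>UNIV. borel) :: (name \<times> nat \<Rightarrow> real) measure"
  have f: "?f \<in> measurable config_space ((?N \<Otimes>\<^sub>M ?R) \<Otimes>\<^sub>M stream_space borel)"
    unfolding config_space_def
    by (rule measurable_vimage_algebra1) (auto simp: space_pair_measure space_PiM space_stream_space)
  have "(\<lambda>y. fst (fst y) (a, i)) \<in> measurable ((?N \<Otimes>\<^sub>M ?R) \<Otimes>\<^sub>M stream_space borel) (count_space UNIV)"
    by measurable
  from measurable_compose[OF f this] show "(\<lambda>x. nats (fst x) a i) \<in> measurable config_space (count_space UNIV)"
    by (simp add: case_prod_beta)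
  have "(\<lambda>y. snd (fst y) (a, i)) \<in> measurable ((?N \<Otimes>\<^sub>M ?R) \<Otimes>\<^sub>M stream_space borel) borel"
    by measurable
  from measurable_compose[OF f this] show "(\<lambda>x. reals (fst x) a i) \<in> borel_measurable config_space"
    by (simp add: case_prod_beta)
  have "snd \<in> measurable ((?N \<Otimes>\<^sub>M ?R) \<Otimes>\<^sub>M stream_space borel) (stream_space borel)"
    by measurable
  from measurable_compose[OF f this] show "snd \<in> measurable config_space (stream_space borel)"
    by (simp add: case_prod_beta)
qed

lemma measurable_configI:
  fixes f :: "'a \<Rightarrow> config"
  assumes [measurable]: "\<And>a i. (\<lambda>x. nats (fst (f x)) a i) \<in> measurable M (count_space UNIV)"
    and [measurable]: "\<And>a i. (\<lambda>x. reals (fst (f x)) a i) \<in> borel_measurable M"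
    and [measurable]: "(\<lambda>x. snd (f x)) \<in> measurable M (stream_space borel)"
  shows "f \<in> measurable M config_space"
  unfolding config_space_def
proof (rule measurable_vimage_algebra2)
  show "(\<lambda>x. case f x of (s, \<omega>) \<Rightarrow> ((\<lambda>p. nats s (fst p) (snd p), \<lambda>p. reals s (fst p) (snd p)), \<omega>))
     \<in> measurable M (((\<Pi>\<^sub>M p\<in>UNIV. count_space UNIV) \<Otimes>\<^sub>M (\<Pi>\<^sub>M p\<in>UNIV. borel)) \<Otimes>\<^sub>M stream_space borel)"
    unfolding case_prod_beta
    by (intro measurable_Pair measurable_PiM_single') (simp_all add: assms)
qed simp

lemma nval_measurable [measurable]:
  "(\<lambda>x. nval e (fst x)) \<in> measurable config_space (count_space UNIV)"
proof (induction e)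
  case (Nat_Cell a e)
  have "(\<lambda>x. (\<lambda>i x. nats (fst x) a i) (nval e (fst x)) x) \<in> measurable config_space (count_space UNIV)"
    by (rule measurable_compose_countable[OF config_coordinates(1) Nat_Cell])
  then show ?case by simp
qed simp_all

lemma rval_measurable [measurable]: "(\<lambda>x. rval e (fst x)) \<in> borel_measurable config_space"
proof (induction e)
  case (Of_Nat e)
  show ?case by simp
next
  case (Real_Cell a e)
  have "(\<lambda>x. (\<lambda>i x. reals (fst x) a i) (nval e (fst x)) x) \<in> borel_measurable config_space"
    by (rule measurable_compose_countable[OF config_coordinates(2) nval_measurable])
  then show ?case by simp
qed simp_all

lemma bval_measurable [measurable]: "Measurable.pred config_space (\<lambda>x. bval b (fst x))"
proof (induction b)
  case (Less e f)
  have "Measurable.pred config_space (\<lambda>x. k < nval f (fst x))" for k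
    by (rule measurable_compose[OF nval_measurable]) simp
  then have "Measurable.pred config_space (\<lambda>x. (\<lambda>k x. k < nval f (fst x)) (nval e (fst x)) x)"
    by (rule measurable_compose_countable[OF _ nval_measurable])
  then show ?case by simp
qed simp_all

lemma set_nat_measurable:
  assumes [measurable]: "f \<in> measurable config_space (count_space UNIV)"
    "g \<in> measurable config_space (stream_space borel)"
  shows "(\<lambda>x. (set_nat a (nval i (fst x)) (f x) (fst x), g x)) \<in> measurable config_space config_space"
proof (rule measurable_configI)
  note config_coordinates [measurable]
  fix b j
  show "(\<lambda>x. nats (fst (set_nat a (nval i (fst x)) (f x) (fst x), g x)) b j)
      \<in> measurable config_space (count_space UNIV)"
    by (cases "b = a") (simp_all add: set_nat_def fun_upd_def)
  show "(\<lambda>x. reals (fst (set_nat a (nval i (fst x)) (f x) (fst x), g x)) b j)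
      \<in> borel_measurable config_space"
    by (simp add: set_nat_def)
qed simp

lemma set_real_measurable:
  assumes [measurable]: "f \<in> borel_measurable config_space"
    "g \<in> measurable config_space (stream_space borel)"
  shows "(\<lambda>x. (set_real a (nval i (fst x)) (f x) (fst x), g x)) \<in> measurable config_space config_space"
proof (rule measurable_configI)
  note config_coordinates [measurable]
  fix b j
  show "(\<lambda>x. reals (fst (set_real a (nval i (fst x)) (f x) (fst x), g x)) b j)
      \<in> borel_measurable config_space"
    by (cases "b = a") (simp_all add: set_real_def fun_upd_def)
  show "(\<lambda>x. nats (fst (set_real a (nval i (fst x)) (f x) (fst x), g x)) b j)
      \<in> measurable config_space (count_space UNIV)"
    by (simp add: set_real_def config_coordinates)
qed simp

lemma function_step:
  assumes f: "f \<in> measurable config_space config_space" and A: "A \<in> sets config_space"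
    and eq: "\<And>x t y. exec c x t y \<longleftrightarrow> t = k \<and> y = f x"
  shows "{x. \<exists>y\<in>A. exec c x t y} \<in> sets config_space"
proof -
  have "{x. \<exists>y\<in>A. exec c x t y} = (if t = k then f -` A \<inter> space config_space else {})"
    by (auto simp: eq)
  then show ?thesis using measurable_sets[OF f A] by simp
qed

lemma exec_Seq_iff:
  "exec (Seq c d) x t z \<longleftrightarrow> (\<exists>u\<le>t. \<exists>y. exec c x u y \<and> exec d y (t - u) z)"
proof
  assume "exec (Seq c d) x t z"
  then show "\<exists>u\<le>t. \<exists>y. exec c x u y \<and> exec d y (t - u) z"
  proof cases
    case (Seq u y v)
    then have "u \<le> t" "t - u = v" by auto
    then show ?thesis using Seq by blast
  qed
next
  assume "\<exists>u\<le>t. \<exists>y. exec c x u y \<and> exec d y (t - u) z"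
  then obtain u y where "u \<le> t" "exec c x u y" "exec d y (t - u) z" by blast
  then show "exec (Seq c d) x t z" using exec.Seq[of c x u y d "t - u" z] by simp
qed

lemma exec_If_iff:
  "exec (If b c d) x t y \<longleftrightarrow> 0 < t \<and> exec (if bval b (fst x) then c else d) x (t - 1) y"
proof
  assume "exec (If b c d) x t y"
  then show "0 < t \<and> exec (if bval b (fst x) then c else d) x (t - 1) y"
    by cases auto
next
  assume "0 < t \<and> exec (if bval b (fst x) then c else d) x (t - 1) y"
  then show "exec (If b c d) x t y"
    using exec.If_True[of b x c "t - 1" y d] exec.If_False[of b x d "t - 1" y c]
    by (cases "bval b (fst x)") auto
qed

lemma exec_measurable:
  assumes "A \<in> sets config_space"
  shows "{x. \<exists>y\<in>A. exec c x t y} \<in> sets config_space"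
  using assms
proof (induction c arbitrary: t A)
  case SKIP
  show ?case
    by (rule function_step[where f = "\<lambda>x. x" and k = 0, OF measurable_ident_sets[OF refl] SKIP])
      (subst exec.simps, auto)
next
  case (Nat_Assign a i e)
  show ?case
    by (rule function_step[where k = 1,
          OF set_nat_measurable[OF nval_measurable[of e] config_coordinates(3), of a i] Nat_Assign])
      (subst exec.simps, auto)
next
  case (Real_Assign a i e)
  show ?case
    by (rule function_step[where k = 1,
          OF set_real_measurable[OF rval_measurable[of e] config_coordinates(3), of a i] Real_Assign])
      (subst exec.simps, auto)
next
  case (Nat_Draw a i e)
  note config_coordinates(3) [measurable]
  have 1: "(\<lambda>x. nat \<lfloor>shd (snd x) * real (nval e (fst x))\<rfloor>) \<in> measurable config_space (count_space UNIV)"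
    by measurable
  have 2: "(\<lambda>x. stl (snd x)) \<in> measurable config_space (stream_space borel)"
    by measurable
  show ?case
    by (rule function_step[where k = 1, OF set_nat_measurable[OF 1 2, of a i] Nat_Draw])
      (subst exec.simps, auto)
next
  case (Real_Draw a i l h)
  note config_coordinates(3) [measurable]
  have 1: "(\<lambda>x. rval l (fst x) + shd (snd x) * (rval h (fst x) - rval l (fst x))) \<in> borel_measurable config_space"
    by measurable
  have 2: "(\<lambda>x. stl (snd x)) \<in> measurable config_space (stream_space borel)"
    by measurable
  show ?case
    by (rule function_step[where k = 1, OF set_real_measurable[OF 1 2, of a i] Real_Draw])
      (subst exec.simps, auto)
next
  case (Seq c d)
  have "{x. \<exists>y\<in>A. exec (Seq c d) x t y} =
      (\<Union>u\<in>{..t}. {x. \<exists>y\<in>{y. \<exists>z\<in>A. exec d y (t - u) z}. exec c x u y})"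
    unfolding exec_Seq_iff by blast
  also have "\<dots> \<in> sets config_space"
    by (intro sets.finite_UN finite_atMost Seq.IH Seq.prems)
  finally show ?case .
next
  case (If b c d)
  let ?B = "{x \<in> space config_space. bval b (fst x)}"
  have "{x. \<exists>y\<in>A. exec (If b c d) x t y} =
      (if t = 0 then {} else (?B \<inter> {x. \<exists>y\<in>A. exec c x (t - 1) y}) \<union>
        ((space config_space - ?B) \<inter> {x. \<exists>y\<in>A. exec d x (t - 1) y}))"
    unfolding exec_If_iff by auto
  moreover have "?B \<in> sets config_space" by measurable
  ultimately show ?case using If by auto
next
  case (While b c)
  let ?B = "{x \<in> space config_space. bval b (fst x)}"
  have B: "?B \<in> sets config_space" by measurable
  show ?case using While.prems
  proof (induction t arbitrary: A rule: less_induct)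
    case (less t)
    let ?W = "\<lambda>u. {x. \<exists>y\<in>{y. \<exists>z\<in>A. exec (While b c) y (t - 1 - u) z}. exec c x u y}"
    have "{x. \<exists>y\<in>A. exec (While b c) x t y} =
        (if t = 1 then (space config_space - ?B) \<inter> A else {}) \<union> (\<Union>u\<in>{..<t}. ?B \<inter> ?W u)"
      (is "?L = ?R")
    proof
      show "?L \<subseteq> ?R"
      proof
        fix x assume "x \<in> ?L"
        then obtain y where y: "y \<in> A" "exec (While b c) x t y" by auto
        from y(2) show "x \<in> ?R"
        proof cases
          case While_False
          then show ?thesis using y by auto
        next
          case (While_True u y' v)
          then have "t - 1 - u = v" "u < t" by auto
          then show ?thesis using While_True y by fastforce
        qed
      qed
      show "?R \<subseteq> ?L"
      proof
        fix x assume "x \<in> ?R"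
        then consider "t = 1" "\<not> bval b (fst x)" "x \<in> A"
          | u y z where "u < t" "bval b (fst x)" "exec c x u y"
              "exec (While b c) y (t - 1 - u) z" "z \<in> A"
          by (auto split: if_splits)
        then show "x \<in> ?L"
        proof cases
          case 1
          then show ?thesis using exec.While_False[of b x c] by blast
        next
          case 2
          have "1 + u + (t - 1 - u) = t" using 2(1) by simp
          then show ?thesis using exec.While_True[OF 2(2-4)] 2(5) by auto
        qed
      qed
    qed
    moreover have "?B \<inter> ?W u \<in> sets config_space" if "u < t" for u
      using that less by (intro sets.Int While.IH B less.IH) auto
    moreover have "(if t = 1 then (space config_space - ?B) \<inter> A else {}) \<in> sets config_space"
      using sets.Int[OF sets.compl_sets[OF B] less.prems]
      by (cases "t = 1") (simp_all only: simp_thms if_True if_False sets.empty_sets)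
    ultimately show ?case by (simp only:) (intro sets.Un sets.finite_UN finite_lessThan, auto)
  qed
qed

lemma time_measurable: "time c \<in> borel_measurable config_space"
proof -
  have [measurable]: "Measurable.pred config_space (\<lambda>x. \<exists>y. exec c x t y)" for t
    using exec_measurable[OF sets.top, of c t] by (simp add: pred_def)
  have "time c x = (INF t. if \<exists>y. exec c x t y then of_nat t else \<infinity>)" for x
    unfolding time_def
  proof (rule antisym; rule INF_greatest)
    fix t
    show "(INF t\<in>{t. \<exists>y. exec c x t y}. of_nat t) \<le> (if \<exists>y. exec c x t y then of_nat t else \<infinity> :: ennreal)"
      by (cases "\<exists>y. exec c x t y") (auto intro!: INF_lower)
  next
    fix t assume "t \<in> {t. \<exists>y. exec c x t y}"
    then show "(INF t. if \<exists>y. exec c x t y then of_nat t else \<infinity>) \<le> (of_nat t :: ennreal)"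
      by (intro INF_lower2[of t]) auto
  qed
  then have "time c = (\<lambda>x. INF t. if \<exists>y. exec c x t y then of_nat t else \<infinity>)" by blast
  also have "\<dots> \<in> borel_measurable config_space"
    by measurable
  finally show ?thesis .
qed

lemma run_measurable: "run c \<in> measurable config_space config_space"
proof (rule measurableI)
  fix A assume A: "A \<in> sets config_space"
  let ?H = "\<lambda>A. \<Union>t. {x. \<exists>y\<in>A. exec c x t y}"
  have "run c -` A \<inter> space config_space =
      ?H A \<union> (if (THE y. False) \<in> A then space config_space - ?H UNIV else {})"
    (is "?L = ?R")
  proof -
    have "x \<in> ?L \<longleftrightarrow> x \<in> ?R" for x
    proof (cases "\<exists>t y. exec c x t y")
      case True
      then obtain t y where "exec c x t y" by auto
      then have "x \<in> ?H UNIV" "x \<in> ?H A \<longleftrightarrow> y \<in> A" "run c x = y"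
        using run_eq exec_deterministic by blast+
      then show ?thesis by auto
    next
      case False
      then have "(\<lambda>y. \<exists>t. exec c x t y) = (\<lambda>y. False)" by blast
      then have "run c x = (THE y. False)" by (simp add: run_def)
      then show ?thesis using False by auto
    qed
    then show ?thesis by blast
  qed
  also have "\<dots> \<in> sets config_space"
  proof -
    have H: "?H B \<in> sets config_space" if "B \<in> sets config_space" for B
      using exec_measurable[OF that] by blast
    have "?H UNIV \<in> sets config_space"
      using H[OF sets.top] by (simp only: space_config_space)
    then show ?thesis using H[OF A] by (auto simp del: space_config_space)
  qed
  finally show "run c -` A \<inter> space config_space \<in> sets config_space" .
qed simp

lemma coins_to_config: "(\<lambda>\<omega>. (s, \<omega>)) \<in> measurable coins config_space"
proof (rule measurable_configI)
  have "sets coins = sets (stream_space borel)"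
    unfolding coins_def by (intro sets_stream_space_cong) simp
  then show "(\<lambda>\<omega>. snd (s, \<omega>)) \<in> measurable coins (stream_space borel)"
    by (simp add: measurable_ident_sets)
qed simp_all

lemma running_time_measurable: "(\<lambda>\<omega>. time d (run c (s, \<omega>))) \<in> borel_measurable coins"
  by (intro measurable_compose[OF _ time_measurable] measurable_compose[OF _ run_measurable]
      coins_to_config)

end

theory Submission
  imports Defs
begin

text \<open>
  From a free row, walk at random: go to column \<open>v\<close> with probability \<open>M\<^sub>u\<^sub>v\<close> and on to the row matched
  with \<open>v\<close>, until a column is free. Since the columns sum to \<open>1\<close>, the expected numbers of steps, summed
  over all free rows as starting points, are at most \<open>n\<close>. So from a random one of \<open>k\<close> free rows
  the walk takes at most \<open>n/k\<close> steps on average, which adds up to \<open>n\<close> times the \<open>n\<close>-th harmonic number.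
  Each step samples a column by binary search in the prefix sums of a row, in time \<open>O(log n)\<close>. Every row
  remembers the column by which it was left last; following these pointers from the start again
  gives the loop-erased walk, along which the matching is augmented. The edge to the matched row
  itself need not be excluded from the walk, since such steps are covered by the same count.
\<close>

section \<open>Expected running times\<close>

text \<open>The distribution of the matching reached after some rounds is not controlled, and
  nothing is claimed about it: the bound on the hitting times holds for every partial matching, so
  the cost of the remaining rounds can be bounded in terms of the number \<open>k\<close> of free
  rows alone, which becomes the whole abstract state of the main loop. The randomness needed for
  averaging is the fresh draw of the starting row in each round.

  Cancelling the matched rows in the sum of all hitting times is legitimate only between finite
  numbers, and hitting times are not known to be finite in advance. Hence the walk is cut off after
  \<open>T\<close> steps, the cancellation is done there, and \<open>T\<close> tends to infinity.

  On the side of programs, expectations over executions are compared with the transformer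
  \<open>ert\<close> once and for all; afterwards each loop is bounded by a potential function. The
  preprocessing has to halt in time for every stream, not just almost surely. Its bound comes from
  \<open>ert\<close> as well, because it draws nothing.\<close>

abbreviation uniform01 :: "real measure" where
  "uniform01 \<equiv> uniform_measure lborel {0..<1}"

lemma prob_space_uniform01: "prob_space uniform01"
  by (rule prob_space_uniform_measure) auto

text \<open>
  \<open>ert c f s\<close> is the expected value of the running time of \<open>c\<close> from \<open>s\<close> plus \<open>f\<close> of the final memory. A
  postcondition is encoded as an \<open>f\<close> with values \<open>0\<close> and \<open>\<infinity>\<close>.
\<close>

primrec ert :: "com \<Rightarrow> (memory \<Rightarrow> ennreal) \<Rightarrow> memory \<Rightarrow> ennreal" where
  "ert SKIP f = f"
| "ert (Nat_Assign a i e) f = (\<lambda>s. 1 + f (set_nat a (nval i s) (nval e s) s))"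
| "ert (Real_Assign a i e) f = (\<lambda>s. 1 + f (set_real a (nval i s) (rval e s) s))"
| "ert (Nat_Draw a i k) f =
     (\<lambda>s. 1 + (\<integral>\<^sup>+x. f (set_nat a (nval i s) (nat \<lfloor>x * real (nval k s)\<rfloor>) s) \<partial>uniform01))"
| "ert (Real_Draw a i l h) f =
     (\<lambda>s. 1 + (\<integral>\<^sup>+x. f (set_real a (nval i s) (rval l s + x * (rval h s - rval l s)) s) \<partial>uniform01))"
| "ert (Seq c d) f = ert c (ert d f)"
| "ert (If b c d) f = (\<lambda>s. 1 + (if bval b s then ert c f s else ert d f s))"
| "ert (While b c) f = lfp (\<lambda>X s. 1 + (if bval b s then ert c X s else f s))"

lemma ert_mono: "(\<And>s. f s \<le> g s) \<Longrightarrow> ert c f s \<le> ert c g s"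
proof (induction c arbitrary: f g s)
  case (While b c)
  have "lfp (\<lambda>X s. 1 + (if bval b s then ert c X s else f s))
      \<le> lfp (\<lambda>X s. 1 + (if bval b s then ert c X s else g s))"
    by (intro lfp_mono le_funI) (use While.prems in \<open>auto intro: add_left_mono\<close>)
  then show ?case by (simp add: le_fun_def)
qed (auto intro!: add_left_mono nn_integral_mono)

lemma mono_ert_While: "mono (\<lambda>X s. 1 + (if bval b s then ert c X s else f s))"
  by (intro monoI le_funI) (auto intro!: add_left_mono ert_mono simp: le_fun_def)

lemma ert_While_unfold:
  "ert (While b c) f s = 1 + (if bval b s then ert c (ert (While b c) f) s else f s)"
  using fun_cong[OF lfp_unfold[OF mono_ert_While[of b c f]], of s] by (simp only: ert.simps)

section \<open>Soundness of \<open>ert\<close> for the expected time of executions\<close>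

lemma time_infinite: "\<nexists>t y. exec c x t y \<Longrightarrow> time c x = \<infinity>"
  by (simp add: time_def)

text \<open>If one of the two parts diverges, the right side is infinite, so the unspecified value
  of \<open>run\<close> does no harm there.\<close>

lemma time_run_Seq_le:
  "time (Seq c d) x + g (run (Seq c d) x) \<le> time c x + (time d (run c x) + g (run d (run c x)))"
proof (cases "(\<exists>t y. exec c x t y) \<and> (\<exists>t z. exec d (run c x) t z)")
  case True
  then obtain t y u z where 1: "exec c x t y" and 2: "exec d y u z" by (auto simp: run_eq)
  from exec.Seq[OF this] show ?thesis using 1 2
    by (simp add: run_eq time_eq add.assoc)
next
  case False
  then show ?thesis by (auto simp: time_infinite)
qed

lemma time_run_While_False:
  assumes "\<not> bval b (fst x)"
  shows "time (While b c) x = 1" "run (While b c) x = x"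
  using exec.While_False[of b x c] assms by (auto simp: time_eq run_eq)

lemma time_run_While_True_le:
  assumes "bval b (fst x)"
  shows "time (While b c) x + g (run (While b c) x) \<le>
    1 + (time c x + (time (While b c) (run c x) + g (run (While b c) (run c x))))"
proof (cases "(\<exists>t y. exec c x t y) \<and> (\<exists>t z. exec (While b c) (run c x) t z)")
  case True
  then obtain t y u z where 1: "exec c x t y" and 2: "exec (While b c) y u z" by (auto simp: run_eq)
  from exec.While_True[OF assms this] show ?thesis using 1 2
    by (simp add: run_eq time_eq add.assoc flip: of_nat_Suc) (simp add: ac_simps)
next
  case False
  then show ?thesis by (auto simp: time_infinite)
qed

text \<open>The cost of the loop up to its \<open>N\<close>-th test, with everything later counted
  as \<open>0\<close>. These truncations are measurable and increase with \<open>N\<close>, so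
  monotone convergence applies to them. Measurability is thus only required of costs of executions;
  of \<open>ert\<close>, monotonicity suffices.\<close>

primrec while_approx ::
    "bexp \<Rightarrow> com \<Rightarrow> (config \<Rightarrow> ennreal) \<Rightarrow> nat \<Rightarrow> config \<Rightarrow> ennreal" where
  "while_approx b c g 0 x = 0"
| "while_approx b c g (Suc N) x =
     1 + (if bval b (fst x) then time c x + while_approx b c g N (run c x) else g x)"

lemma while_approx_mono: "while_approx b c g N x \<le> while_approx b c g (Suc N) x"
  by (induction N arbitrary: x) (auto intro!: add_left_mono)

text \<open>Every test costs a step. So either the loop is still running after \<open>N\<close>
  tests and has cost at least \<open>N\<close>, or it has ended and its whole cost has been
  counted.\<close>

lemma while_approx_complete:
  "of_nat N \<le> while_approx b c g N x \<or>
   time (While b c) x + g (run (While b c) x) \<le> while_approx b c g N x"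
proof (induction N arbitrary: x)
  case (Suc N)
  show ?case
  proof (cases "bval b (fst x)")
    case False
    then show ?thesis by (simp add: time_run_While_False)
  next
    case b: True
    from Suc.IH[of "run c x"] show ?thesis
    proof
      assume "of_nat N \<le> while_approx b c g N (run c x)"
      then have "of_nat (Suc N) \<le> while_approx b c g (Suc N) x"
        using b by (simp add: add_increasing add_left_mono)
      then show ?thesis ..
    next
      assume "time (While b c) (run c x) + g (run (While b c) (run c x))
        \<le> while_approx b c g N (run c x)"
      then have "1 + (time c x + (time (While b c) (run c x) + g (run (While b c) (run c x))))
          \<le> while_approx b c g (Suc N) x"
        using b by (auto intro!: add_left_mono)
      with time_run_While_True_le[OF b] show ?thesis by (blast intro: order_trans)
    qed
  qed
qed simp

text \<open>If no truncation covers the whole cost, then the truncations exceed every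
  \<open>N\<close> and their supremum is infinite; this disposes of divergence.\<close>

lemma time_run_While_le_SUP:
  "time (While b c) x + g (run (While b c) x) \<le> (SUP N. while_approx b c g N x)"
proof (cases "\<exists>N. time (While b c) x + g (run (While b c) x) \<le> while_approx b c g N x")
  case True
  then show ?thesis by (meson SUP_upper2 UNIV_I)
next
  case False
  then have "of_nat N \<le> while_approx b c g N x" for N
    using while_approx_complete by blast
  then have "(SUP N. of_nat N) \<le> (SUP N. while_approx b c g N x)"
    by (intro SUP_mono) auto
  then have "(SUP N. while_approx b c g N x) = \<infinity>"
    by (simp only: ennreal_SUP_of_nat_eq_top top_unique infinity_ennreal_def)
  then show ?thesis by (simp only: infinity_ennreal_def top_greatest)
qed

lemma sets_coins: "sets coins = sets (stream_space borel)"
  unfolding coins_def by (intro sets_stream_space_cong) simp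

lemma prob_space_coins: "prob_space coins"
  unfolding coins_def by (intro prob_space.prob_space_stream_space prob_space_uniform01)

lemma measurable_time_run:
  assumes "g \<in> borel_measurable config_space"
  shows "(\<lambda>x. time c x + g (run c x)) \<in> borel_measurable config_space"
  using time_measurable measurable_compose[OF run_measurable assms] by (rule borel_measurable_add)

lemma measurable_while_approx:
  assumes g: "g \<in> borel_measurable config_space"
  shows "while_approx b c g N \<in> borel_measurable config_space"
proof (induction N)
  case (Suc N)
  note [measurable] = measurable_compose[OF run_measurable Suc] g time_measurable
  show ?case unfolding while_approx.simps by measurable
qed simp

lemma nn_integral_coins_draw:
  assumes "g \<in> borel_measurable (stream_space borel)"
  shows "(\<integral>\<^sup>+\<omega>. g \<omega> \<partial>coins) = (\<integral>\<^sup>+x. \<integral>\<^sup>+\<omega>. g (x ## \<omega>) \<partial>coins \<partial>uniform01)"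
proof -
  interpret prob_space uniform01 by (rule prob_space_uniform01)
  show ?thesis unfolding coins_def
    by (rule nn_integral_stream_space) (use assms sets_coins in \<open>simp add: measurable_def coins_def cong: measurable_cong_sets\<close>)
qed


text \<open>Both kinds of draw consume one number and differ only in the memory \<open>h x\<close>
  made from it. The tail of the stream is independent of that number and again distributed as
  \<open>coins\<close>.\<close>

lemma nn_integral_draw:
  assumes g: "g \<in> borel_measurable config_space"
    and step: "\<And>\<omega>. exec c (s, \<omega>) 1 (h (shd \<omega>), stl \<omega>)"
  shows "(\<integral>\<^sup>+\<omega>. time c (s, \<omega>) + g (run c (s, \<omega>)) \<partial>coins)
    = 1 + (\<integral>\<^sup>+x. \<integral>\<^sup>+\<omega>. g (h x, \<omega>) \<partial>coins \<partial>uniform01)"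
proof -
  interpret coins: prob_space coins by (rule prob_space_coins)
  interpret U: prob_space uniform01 by (rule prob_space_uniform01)
  have meas: "(\<lambda>\<omega>. g (run c (s, \<omega>))) \<in> borel_measurable coins"
    by (rule measurable_compose[OF _ measurable_compose[OF run_measurable g]]) (rule coins_to_config)
  have eq: "run c (s, \<omega>) = (h (shd \<omega>), stl \<omega>)" for \<omega>
    using run_eq[OF step[of \<omega>]] by simp
  have "(\<lambda>p. fst p ## snd p) \<in> measurable (borel \<Otimes>\<^sub>M stream_space borel) (stream_space borel)"
    by measurable
  then have "(\<lambda>p. fst p ## snd p) \<in> measurable (uniform01 \<Otimes>\<^sub>M coins) coins"
    by (subst measurable_cong_sets) (auto simp: sets_coins intro!: sets_pair_measure_cong)
  from measurable_compose[OF this meas]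
  have "(\<lambda>p. g (h (fst p), snd p)) \<in> borel_measurable (uniform01 \<Otimes>\<^sub>M coins)"
    by (simp add: eq)
  then have meas': "(\<lambda>x. \<integral>\<^sup>+\<omega>. g (h x, \<omega>) \<partial>coins) \<in> borel_measurable uniform01"
    by (intro coins.borel_measurable_nn_integral) (simp add: case_prod_beta')
  have "(\<integral>\<^sup>+\<omega>. time c (s, \<omega>) + g (run c (s, \<omega>)) \<partial>coins) = 1 + (\<integral>\<^sup>+\<omega>. g (run c (s, \<omega>)) \<partial>coins)"
    using meas time_eq[OF step] by (simp add: nn_integral_add coins.emeasure_space_1)
  also have "(\<integral>\<^sup>+\<omega>. g (run c (s, \<omega>)) \<partial>coins) = (\<integral>\<^sup>+x. \<integral>\<^sup>+\<omega>. g (h x, \<omega>) \<partial>coins \<partial>uniform01)"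
    by (subst nn_integral_coins_draw) (use meas in \<open>simp_all add: eq measurable_cong_sets[OF sets_coins]\<close>)
  finally show ?thesis .
qed

text \<open>
  The argument \<open>\<lambda>s. \<integral>\<^sup>+\<omega>. g (s, \<omega>) \<partial>coins\<close> of \<open>ert\<close> is what makes the induction go through for
  sequential composition: the numbers not drawn by \<open>c\<close> are still independent and uniform.
\<close>

theorem nn_integral_time_run_le_ert:
  assumes "g \<in> borel_measurable config_space"
  shows "(\<integral>\<^sup>+\<omega>. time c (s, \<omega>) + g (run c (s, \<omega>)) \<partial>coins)
    \<le> ert c (\<lambda>s. \<integral>\<^sup>+\<omega>. g (s, \<omega>) \<partial>coins) s"
  using assms
proof (induction c arbitrary: g s)
  case SKIP
  have "time SKIP x = 0" "run SKIP x = x" for x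
    using exec.Skip[of x] by (auto simp: time_eq run_eq)
  then show ?case by simp
next
  case (Nat_Assign a i e)
  interpret coins: prob_space coins by (rule prob_space_coins)
  note [measurable] = measurable_compose[OF coins_to_config Nat_Assign]
  show ?case
    by (simp add: time_eq[OF exec.Nat_Assign] run_eq[OF exec.Nat_Assign] nn_integral_add
        coins.emeasure_space_1)
next
  case (Real_Assign a i e)
  interpret coins: prob_space coins by (rule prob_space_coins)
  note [measurable] = measurable_compose[OF coins_to_config Real_Assign]
  show ?case
    by (simp add: time_eq[OF exec.Real_Assign] run_eq[OF exec.Real_Assign] nn_integral_add
        coins.emeasure_space_1)
next
  case (Nat_Draw a i k)
  then show ?case by (subst nn_integral_draw[OF _ exec.Nat_Draw]) simp_all
next
  case (Real_Draw a i l h)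
  then show ?case by (subst nn_integral_draw[OF _ exec.Real_Draw]) simp_all
next
  case (Seq c d)
  have "(\<integral>\<^sup>+\<omega>. time (Seq c d) (s, \<omega>) + g (run (Seq c d) (s, \<omega>)) \<partial>coins)
    \<le> (\<integral>\<^sup>+\<omega>. time c (s, \<omega>) + (time d (run c (s, \<omega>)) + g (run d (run c (s, \<omega>)))) \<partial>coins)"
    by (intro nn_integral_mono time_run_Seq_le)
  also have "\<dots> \<le> ert c (\<lambda>s. \<integral>\<^sup>+\<omega>. time d (s, \<omega>) + g (run d (s, \<omega>)) \<partial>coins) s"
    using Seq.IH(1)[OF measurable_time_run[OF Seq.prems]] .
  also have "\<dots> \<le> ert c (ert d (\<lambda>s. \<integral>\<^sup>+\<omega>. g (s, \<omega>) \<partial>coins)) s"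
    by (intro ert_mono Seq.IH(2) Seq.prems)
  finally show ?case by simp
next
  case (If b c d)
  interpret coins: prob_space coins by (rule prob_space_coins)
  let ?e = "if bval b s then c else d"
  have "time (If b c d) (s, \<omega>) + g (run (If b c d) (s, \<omega>)) \<le>
      1 + (time ?e (s, \<omega>) + g (run ?e (s, \<omega>)))" for \<omega>
  proof (cases "\<exists>t y. exec ?e (s, \<omega>) t y")
    case True
    then obtain t y where 1: "exec ?e (s, \<omega>) t y" by auto
    then have "exec (If b c d) (s, \<omega>) (1 + t) y"
      by (subst exec_If_iff) auto
    then show ?thesis unfolding time_eq[OF 1] run_eq[OF 1] by (simp add: time_eq run_eq add.assoc)
  qed (simp add: time_infinite)
  then have "(\<integral>\<^sup>+\<omega>. time (If b c d) (s, \<omega>) + g (run (If b c d) (s, \<omega>)) \<partial>coins)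
    \<le> (\<integral>\<^sup>+\<omega>. 1 + (time ?e (s, \<omega>) + g (run ?e (s, \<omega>))) \<partial>coins)"
    by (intro nn_integral_mono)
  also have "\<dots> = 1 + (\<integral>\<^sup>+\<omega>. time ?e (s, \<omega>) + g (run ?e (s, \<omega>)) \<partial>coins)"
    by (subst nn_integral_add)
      (use measurable_compose[OF coins_to_config measurable_time_run[OF If.prems]]
        in \<open>simp_all add: coins.emeasure_space_1\<close>)
  also have "\<dots> \<le> ert (If b c d) (\<lambda>s. \<integral>\<^sup>+\<omega>. g (s, \<omega>) \<partial>coins) s"
    using If.IH[OF If.prems] by (auto intro!: add_left_mono)
  finally show ?case .
next
  case (While b c)
  interpret coins: prob_space coins by (rule prob_space_coins)
  let ?G = "\<lambda>s. \<integral>\<^sup>+\<omega>. g (s, \<omega>) \<partial>coins"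
  note meas = measurable_while_approx[OF While.prems, of b c]
  \<comment> \<open>The least fixed point lies above all finite unrollings, and these can be handled
    by induction on \<open>N\<close>, with the hypothesis for the body applied to a truncation as
    continuation.\<close>
  have approx: "(\<integral>\<^sup>+\<omega>. while_approx b c g N (s, \<omega>) \<partial>coins) \<le> ert (While b c) ?G s" for N s
  proof (induction N arbitrary: s)
    case (Suc N)
    show ?case
    proof (cases "bval b s")
      case True
      have "(\<integral>\<^sup>+\<omega>. while_approx b c g (Suc N) (s, \<omega>) \<partial>coins)
        = 1 + (\<integral>\<^sup>+\<omega>. time c (s, \<omega>) + while_approx b c g N (run c (s, \<omega>)) \<partial>coins)"
        using measurable_compose[OF coins_to_config measurable_time_run[OF meas[of N]]] True
        by (simp add: nn_integral_add coins.emeasure_space_1)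
      also have "\<dots> \<le> 1 + ert c (\<lambda>s. \<integral>\<^sup>+\<omega>. while_approx b c g N (s, \<omega>) \<partial>coins) s"
        by (intro add_left_mono While.IH meas)
      also have "\<dots> \<le> 1 + ert c (ert (While b c) ?G) s"
        by (intro add_left_mono ert_mono Suc.IH)
      also have "\<dots> = ert (While b c) ?G s"
        using ert_While_unfold[of b c ?G s] True by (simp only: if_True)
      finally show ?thesis .
    next
      case False
      have "(\<integral>\<^sup>+\<omega>. while_approx b c g (Suc N) (s, \<omega>) \<partial>coins) = 1 + ?G s"
        using measurable_compose[OF coins_to_config While.prems] False
        by (simp add: nn_integral_add coins.emeasure_space_1)
      also have "\<dots> = ert (While b c) ?G s"
        using ert_While_unfold[of b c ?G s] False by (simp only: if_False)
      finally show ?thesis by simp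
    qed
  qed simp
  have "(\<integral>\<^sup>+\<omega>. time (While b c) (s, \<omega>) + g (run (While b c) (s, \<omega>)) \<partial>coins)
    \<le> (\<integral>\<^sup>+\<omega>. (SUP N. while_approx b c g N (s, \<omega>)) \<partial>coins)"
    by (intro nn_integral_mono time_run_While_le_SUP)
  also have "\<dots> = (SUP N. \<integral>\<^sup>+\<omega>. while_approx b c g N (s, \<omega>) \<partial>coins)"
    by (intro nn_integral_monotone_convergence_SUP measurable_compose[OF coins_to_config meas]
        incseq_SucI le_funI while_approx_mono)
  also have "\<dots> \<le> ert (While b c) ?G s"
    by (intro SUP_least approx)
  finally show ?case .
qed

section \<open>Programs without draws\<close>

primrec draw_free :: "com \<Rightarrow> bool" where
  "draw_free SKIP \<longleftrightarrow> True"
| "draw_free (Nat_Assign a i e) \<longleftrightarrow> True"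
| "draw_free (Real_Assign a i e) \<longleftrightarrow> True"
| "draw_free (Nat_Draw a i k) \<longleftrightarrow> False"
| "draw_free (Real_Draw a i l h) \<longleftrightarrow> False"
| "draw_free (Seq c d) \<longleftrightarrow> draw_free c \<and> draw_free d"
| "draw_free (If b c d) \<longleftrightarrow> draw_free c \<and> draw_free d"
| "draw_free (While b c) \<longleftrightarrow> draw_free c"

text \<open>Without draws, \<open>ert\<close> bounds the cost of a single execution, so a finite
  value yields termination on every stream. Neither \<open>t\<close> nor \<open>s'\<close> depends
  on the stream, and the stream is handed on intact: a program run afterwards starts in a fixed
  memory with all random numbers still available.\<close>

lemma draw_free_ert:
  assumes "draw_free c" "ert c f s < \<infinity>"
  shows "\<exists>t s'. (\<forall>\<omega>. exec c (s, \<omega>) t (s', \<omega>)) \<and> of_nat t + f s' \<le> ert c f s"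
  using assms
proof (induction c arbitrary: f s)
  case SKIP
  then show ?case using exec.Skip by fastforce
next
  case (Nat_Assign a i e)
  then show ?case using exec.Nat_Assign by (fastforce intro!: exI[of _ 1])
next
  case (Real_Assign a i e)
  then show ?case using exec.Real_Assign by (fastforce intro!: exI[of _ 1])
next
  case (Seq c d)
  from Seq.IH(1)[of "ert d f" s] Seq.prems obtain t s' where
    1: "\<And>\<omega>. exec c (s, \<omega>) t (s', \<omega>)" "of_nat t + ert d f s' \<le> ert (Seq c d) f s" by auto
  from 1(2) have "ert d f s' \<le> ert (Seq c d) f s"
    by (metis add_increasing order_refl order_trans zero_le add.commute le_iff_add)
  then have "ert d f s' < \<infinity>" using Seq.prems(2) by (rule le_less_trans)
  with Seq.IH(2)[of f s'] Seq.prems(1) obtain u s'' where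
    2: "\<And>\<omega>. exec d (s', \<omega>) u (s'', \<omega>)" "of_nat u + f s'' \<le> ert d f s'" by auto
  have "of_nat (t + u) + f s'' \<le> of_nat t + ert d f s'"
    using 2(2) by (simp add: add.assoc add_left_mono)
  then show ?case using exec.Seq[OF 1(1) 2(1)] 1(2) by (meson order_trans)
next
  case (If b c d)
  let ?e = "if bval b s then c else d"
  have e: "ert (If b c d) f s = 1 + ert ?e f s" by simp
  then have "ert ?e f s < \<infinity>" using If.prems(2) by (simp only:) (simp add: ennreal_add_less_top)
  with If.IH[of f s] If.prems(1) obtain t s' where
    1: "\<And>\<omega>. exec ?e (s, \<omega>) t (s', \<omega>)" "of_nat t + f s' \<le> ert ?e f s"
    by (cases "bval b s") auto
  have "exec (If b c d) (s, \<omega>) (1 + t) (s', \<omega>)" for \<omega>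
    using 1(1)[of \<omega>] by (subst exec_If_iff) auto
  moreover have "of_nat (1 + t) + f s' \<le> ert (If b c d) f s"
    using 1(2) by (simp only: e of_nat_add of_nat_1 add.assoc add_left_mono)
  ultimately show ?case by blast
next
  case (While b c)
  let ?X = "ert (While b c) f"
  \<comment> \<open>A finite value of \<open>ert\<close> lies below some natural number
    \<open>N\<close>; each iteration uses up at least one step of it, so \<open>N\<close> serves as
    the induction measure for termination.\<close>
  have "\<exists>t s'. (\<forall>\<omega>. exec (While b c) (s, \<omega>) t (s', \<omega>)) \<and> of_nat t + f s' \<le> ?X s"
    if "?X s < of_nat N" for N s
    using that
  proof (induction N arbitrary: s)
    case (Suc N)
    show ?case
    proof (cases "bval b s")
      case True
      have X: "?X s = 1 + ert c ?X s"
        using ert_While_unfold[of b c f s] True by (simp only: if_True)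
      have less: "ert c ?X s < of_nat N"
        using Suc.prems unfolding X of_nat_Suc
        by (metis add.commute add_left_mono leD leI)
      then have "ert c ?X s < \<infinity>" by (metis infinity_ennreal_def less_top top.not_eq_extremum of_nat_less_top order_less_trans)
      with While.IH[of ?X s] While.prems(1) obtain t s' where
        1: "\<And>\<omega>. exec c (s, \<omega>) t (s', \<omega>)" "of_nat t + ?X s' \<le> ert c ?X s" by auto
      have "?X s' \<le> of_nat t + ?X s'" by (simp add: add_increasing)
      also note 1(2)
      also note less
      finally obtain u s'' where
        2: "\<And>\<omega>. exec (While b c) (s', \<omega>) u (s'', \<omega>)" "of_nat u + f s'' \<le> ?X s'"
        using Suc.IH by blast
      have "of_nat (1 + t + u) + f s'' = 1 + (of_nat t + (of_nat u + f s''))"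
        by (simp add: ac_simps)
      also have "\<dots> \<le> 1 + (of_nat t + ?X s')"
        by (intro add_left_mono 2(2))
      also have "\<dots> \<le> ?X s"
        unfolding X by (intro add_left_mono 1(2))
      finally show ?thesis
        using exec.While_True[of b "(s, _)" c, OF _ 1(1) 2(1)] True by (metis fst_conv)
    next
      case False
      then have "of_nat 1 + f s \<le> ?X s"
        using ert_While_unfold[of b c f s] by (simp only: if_False of_nat_1)
      then show ?thesis using exec.While_False[of b "(s, _)" c] False by (metis fst_conv)
    qed
  qed simp
  moreover obtain N where "?X s < of_nat N"
    using While.prems(2) ennreal_Ex_less_of_nat by (metis infinity_ennreal_def)
  ultimately show ?case by blast
qed simp_all

section \<open>Bounding loops and random draws\<close>

text \<open>
  A loop is bounded by refinement: \<open>I g s\<close> relates an abstract state \<open>g\<close> to the memory \<open>s\<close>, and the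
  cost depends on \<open>g\<close> only. The infimum of the empty set is \<open>\<infinity>\<close>, so a finite bound includes the
  invariance of \<open>I\<close>.
\<close>

definition abstract_cost :: "('g \<Rightarrow> memory \<Rightarrow> bool) \<Rightarrow> ('g \<Rightarrow> ennreal) \<Rightarrow> memory \<Rightarrow> ennreal" where
  "abstract_cost I K s = (INF g\<in>{g. I g s}. K g)"

lemma abstract_cost_le: "I g s \<Longrightarrow> K g \<le> B \<Longrightarrow> abstract_cost I K s \<le> B"
  unfolding abstract_cost_def by (rule INF_lower2[of g]) auto

text \<open>Park induction: \<open>body\<close> and \<open>exit\<close> make
  \<open>abstract_cost I K\<close> a pre-fixed point of the functional whose least fixed point is
  \<open>ert (While b c) f\<close>. Termination needs no separate argument.\<close>

lemma ert_While_le: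
  assumes "I g s"
    and body: "\<And>g s. I g s \<Longrightarrow> bval b s \<Longrightarrow> 1 + ert c (abstract_cost I K) s \<le> K g"
    and exit: "\<And>g s. I g s \<Longrightarrow> \<not> bval b s \<Longrightarrow> 1 + f s \<le> K g"
  shows "ert (While b c) f s \<le> K g"
proof -
  have "ert (While b c) f \<le> abstract_cost I K"
    unfolding ert.simps
  proof (intro lfp_lowerbound le_funI)
    fix s
    show "1 + (if bval b s then ert c (abstract_cost I K) s else f s) \<le> abstract_cost I K s"
      using body exit by (subst abstract_cost_def) (intro INF_greatest, auto)
  qed
  then show ?thesis using abstract_cost_le[where I = I and K = K, OF assms(1)] by (meson le_funD order_refl order_trans)
qed

text \<open>The integrands are values of \<open>ert\<close>, whose measurability is never
  established; they are therefore bounded pointwise by a step function. The cut points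
  \<open>c\<close> will be the prefix sums of a row for the draw of a real, and the multiples of
  \<open>1 / k\<close> for the draw of an index.\<close>

lemma nn_integral_uniform01_le:
  assumes le: "\<And>x. 0 \<le> x \<Longrightarrow> x < 1 \<Longrightarrow> \<exists>j<d. c j \<le> x \<and> x < c (Suc j) \<and> f x \<le> h j"
    and mono: "\<And>j. j < d \<Longrightarrow> c j \<le> c (Suc j)"
  shows "(\<integral>\<^sup>+x. f x \<partial>uniform01) \<le> (\<Sum>j<d. ennreal (c (Suc j) - c j) * h j)"
proof -
  have "(\<integral>\<^sup>+x. f x \<partial>uniform01) \<le> (\<integral>\<^sup>+x. (\<Sum>j<d. indicator {c j..<c (Suc j)} x * h j) \<partial>uniform01)"
  proof (rule nn_integral_mono_AE)
    have "AE x in uniform01. x \<in> {0..<1}"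
      by (intro AE_uniform_measureI) auto
    then show "AE x in uniform01. f x \<le> (\<Sum>j<d. indicator {c j..<c (Suc j)} x * h j)"
    proof eventually_elim
      case (elim x)
      then obtain j where j: "j < d" "c j \<le> x" "x < c (Suc j)" "f x \<le> h j" using le by auto
      then have "f x \<le> indicator {c j..<c (Suc j)} x * h j" by simp
      also have "\<dots> \<le> (\<Sum>j<d. indicator {c j..<c (Suc j)} x * h j)"
        using j(1) by (intro member_le_sum) auto
      finally show ?case .
    qed
  qed
  also have "\<dots> = (\<Sum>j<d. emeasure uniform01 {c j..<c (Suc j)} * h j)"
  proof (subst nn_integral_sum)
    show "(\<Sum>j<d. \<integral>\<^sup>+x. indicator {c j..<c (Suc j)} x * h j \<partial>uniform01)
      = (\<Sum>j<d. emeasure uniform01 {c j..<c (Suc j)} * h j)"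
      by (intro sum.cong refl) (subst nn_integral_multc, auto)
  qed simp
  also have "\<dots> \<le> (\<Sum>j<d. ennreal (c (Suc j) - c j) * h j)"
  proof (intro sum_mono mult_right_mono)
    fix j assume "j \<in> {..<d}"
    then have "emeasure uniform01 {c j..<c (Suc j)} = emeasure lborel ({0..<1} \<inter> {c j..<c (Suc j)})"
      by (subst emeasure_uniform_measure) (auto simp: divide_ennreal_def)
    also have "\<dots> \<le> emeasure lborel {c j..<c (Suc j)}"
      by (intro emeasure_mono) auto
    also have "\<dots> = ennreal (c (Suc j) - c j)"
      using mono \<open>j \<in> {..<d}\<close> by simp
    finally show "emeasure uniform01 {c j..<c (Suc j)} \<le> ennreal (c (Suc j) - c j)" .
  qed simp
  finally show ?thesis .
qed

section \<open>Hitting times of the random walk\<close>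

text \<open>The expected number of steps of the walk from \<open>u\<close>, stopped after
  \<open>T\<close> steps. The truncation keeps the values finite, as the cancellation in
  \<open>sum_hitting_time_le\<close> requires.\<close>

primrec hitting_approx ::
    "nat \<Rightarrow> (nat \<Rightarrow> nat \<Rightarrow> real) \<Rightarrow> (nat \<Rightarrow> nat) \<Rightarrow> nat \<Rightarrow> nat \<Rightarrow> ennreal" where
  "hitting_approx n w m 0 u = 0"
| "hitting_approx n w m (Suc T) u = 1 + (\<Sum>v<n. ennreal (w u v) *
     (case m v of 0 \<Rightarrow> 0 | Suc u' \<Rightarrow> hitting_approx n w m T u'))"

definition hitting_time ::
    "nat \<Rightarrow> (nat \<Rightarrow> nat \<Rightarrow> real) \<Rightarrow> (nat \<Rightarrow> nat) \<Rightarrow> nat \<Rightarrow> ennreal" where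
  "hitting_time n w m u = (SUP T. hitting_approx n w m T u)"

lemma hitting_approx_mono: "hitting_approx n w m T u \<le> hitting_approx n w m (Suc T) u"
proof (induction T arbitrary: u)
  case (Suc T)
  show ?case
    unfolding hitting_approx.simps(2)[of n w m "Suc T" u] hitting_approx.simps(2)[of n w m T u]
    by (intro add_left_mono sum_mono mult_left_mono)
      (simp_all add: Suc del: hitting_approx.simps split: nat.split)
qed simp

text \<open>First-step analysis, carried over to the limit by monotone convergence. In this
  direction it lets the hitting time of the present row pay for one step and for the expected
  rest.\<close>

lemma hitting_time_step:
  "1 + (\<Sum>v<n. ennreal (w u v) * (case m v of 0 \<Rightarrow> 0 | Suc u' \<Rightarrow> hitting_time n w m u'))
    \<le> hitting_time n w m u"
proof -
  let ?h = "\<lambda>T v. case m v of 0 \<Rightarrow> 0 | Suc u' \<Rightarrow> hitting_approx n w m T u'"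
  have inc: "incseq (\<lambda>T. ennreal (w u v) * ?h T v)" for v
    by (intro incseq_SucI mult_left_mono)
      (auto split: nat.splits simp: hitting_approx_mono simp del: hitting_approx.simps)
  have "(\<Sum>v<n. ennreal (w u v) * (case m v of 0 \<Rightarrow> 0 | Suc u' \<Rightarrow> hitting_time n w m u'))
    = (\<Sum>v<n. SUP T. ennreal (w u v) * ?h T v)"
    by (intro sum.cong refl)
      (auto split: nat.splits simp: hitting_time_def SUP_mult_left_ennreal)
  also have "\<dots> = (SUP T. \<Sum>v<n. ennreal (w u v) * ?h T v)"
    using inc by (intro ennreal_SUP_sum[symmetric]) auto
  finally have "1 + (\<Sum>v<n. ennreal (w u v) * (case m v of 0 \<Rightarrow> 0 | Suc u' \<Rightarrow> hitting_time n w m u'))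
    = (SUP T. hitting_approx n w m (Suc T) u)"
    by (simp add: ennreal_SUP_add_right)
  also have "\<dots> \<le> hitting_time n w m u"
    unfolding hitting_time_def by (intro SUP_mono) blast
  finally show ?thesis .
qed

text \<open>Column \<open>v\<close> is matched to row \<open>u\<close> iff \<open>m v = Suc u\<close>, and free iff \<open>m v = 0\<close>.\<close>

definition partial_matching :: "nat \<Rightarrow> real mat \<Rightarrow> (nat \<Rightarrow> nat) \<Rightarrow> (nat \<Rightarrow> nat) \<Rightarrow> bool" where
  "partial_matching n M m \<mu> \<longleftrightarrow>
     (\<forall>u v. v < n \<longrightarrow> m v = Suc u \<longrightarrow> u < n \<and> \<mu> u = v \<and> M $$ (u, v) \<noteq> 0)"

definition free_rows :: "nat \<Rightarrow> (nat \<Rightarrow> nat) \<Rightarrow> nat set" where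
  "free_rows n m = {u. u < n \<and> (\<forall>v<n. m v \<noteq> Suc u)}"

lemma free_rows_subset: "free_rows n m \<subseteq> {..<n}"
  by (auto simp: free_rows_def)

lemma partial_matching_inj:
  "partial_matching n M m \<mu> \<Longrightarrow> v < n \<Longrightarrow> v' < n \<Longrightarrow> m v = Suc u \<Longrightarrow> m v' = Suc u \<Longrightarrow> v = v'"
  unfolding partial_matching_def by metis

lemma sum_mates:
  fixes h :: "nat \<Rightarrow> ennreal"
  assumes "partial_matching n M m \<mu>"
  shows "(\<Sum>v<n. case m v of 0 \<Rightarrow> 0 | Suc u \<Rightarrow> h u) = (\<Sum>u\<in>{..<n} - free_rows n m. h u)"
proof -
  have "(\<Sum>v<n. case m v of 0 \<Rightarrow> 0 | Suc u \<Rightarrow> h u)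
      = (\<Sum>v\<in>{v. v < n \<and> m v \<noteq> 0}. h (m v - 1))"
    by (rule sum.mono_neutral_cong_right) (auto split: nat.splits)
  also have "\<dots> = (\<Sum>u\<in>{..<n} - free_rows n m. h u)"
  proof (rule sum.reindex_bij_betw)
    have "inj_on (\<lambda>v. m v - 1) {v. v < n \<and> m v \<noteq> 0}"
      using partial_matching_inj[OF assms] by (intro inj_onI) (auto, metis Suc_pred)
    moreover have "(\<lambda>v. m v - 1) ` {v. v < n \<and> m v \<noteq> 0} = {..<n} - free_rows n m"
    proof
      show "(\<lambda>v. m v - 1) ` {v. v < n \<and> m v \<noteq> 0} \<subseteq> {..<n} - free_rows n m"
        using assms by (auto simp: partial_matching_def free_rows_def gr0_conv_Suc)
      show "{..<n} - free_rows n m \<subseteq> (\<lambda>v. m v - 1) ` {v. v < n \<and> m v \<noteq> 0}"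
        by (force simp: free_rows_def image_iff)
    qed
    ultimately show "bij_betw (\<lambda>v. m v - 1) {v. v < n \<and> m v \<noteq> 0} ({..<n} - free_rows n m)"
      by (simp add: bij_betw_def)
  qed
  finally show ?thesis .
qed

context
  fixes n :: nat and M :: "real mat"
  assumes ds: "doubly_stochastic n M"
begin

lemma entry_nonneg: "u < n \<Longrightarrow> v < n \<Longrightarrow> 0 \<le> M $$ (u, v)"
  using ds by (simp add: doubly_stochastic_def)

lemma row_sum: "u < n \<Longrightarrow> (\<Sum>v<n. ennreal (M $$ (u, v))) = 1"
  using ds by (subst sum_ennreal) (auto simp: doubly_stochastic_def)

lemma column_sum: "v < n \<Longrightarrow> (\<Sum>u<n. ennreal (M $$ (u, v))) = 1"
  using ds by (subst sum_ennreal) (auto simp: doubly_stochastic_def)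

lemma hitting_approx_le:
  assumes "partial_matching n M m \<mu>" "u < n"
  shows "hitting_approx n (\<lambda>u v. M $$ (u, v)) m T u \<le> of_nat T"
  using assms(2)
proof (induction T arbitrary: u)
  case (Suc T)
  have "hitting_approx n (\<lambda>u v. M $$ (u, v)) m (Suc T) u
      \<le> 1 + (\<Sum>v<n. ennreal (M $$ (u, v)) * of_nat T)"
    unfolding hitting_approx.simps
    using Suc.IH assms(1)
    by (intro add_left_mono sum_mono mult_left_mono) (auto split: nat.splits simp: partial_matching_def)
  also have "\<dots> = of_nat (Suc T)"
    by (simp add: row_sum[OF Suc.prems] flip: sum_distrib_right)
  finally show ?case .
qed simp

text \<open>
  Summed over all rows, the recursion of the hitting times loses nothing because the columns sum to
  \<open>1\<close>; the contribution of the matched rows cancels.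
\<close>

lemma sum_hitting_time_le:
  assumes m: "partial_matching n M m \<mu>"
  shows "(\<Sum>u\<in>free_rows n m. hitting_time n (\<lambda>u v. M $$ (u, v)) m u) \<le> of_nat n"
proof -
  let ?h = "hitting_approx n (\<lambda>u v. M $$ (u, v)) m"
  let ?F = "free_rows n m"
  have le: "(\<Sum>u\<in>?F. ?h T u) \<le> of_nat n" for T
  proof -
    let ?S = "\<Sum>u\<in>{..<n} - ?F. ?h (Suc T) u"
    have "(\<Sum>u<n. ?h (Suc T) u) = (\<Sum>u<n. 1) + (\<Sum>u<n. \<Sum>v<n. ennreal (M $$ (u, v)) *
      (case m v of 0 \<Rightarrow> 0 | Suc u' \<Rightarrow> ?h T u'))"
      by (simp add: sum.distrib)
    also have "\<dots> = of_nat n + (\<Sum>v<n. (\<Sum>u<n. ennreal (M $$ (u, v))) *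
      (case m v of 0 \<Rightarrow> 0 | Suc u' \<Rightarrow> ?h T u'))"
      by (subst sum.swap) (simp add: sum_distrib_right)
    also have "\<dots> = of_nat n + (\<Sum>u\<in>{..<n} - ?F. ?h T u)"
      using sum_mates[OF m] by (simp add: column_sum)
    \<comment> \<open>The mates contribute with horizon \<open>T\<close>; raising it to
      \<open>Suc T\<close> makes the same sum \<open>?S\<close> appear on both sides.\<close>
    also have "\<dots> \<le> of_nat n + ?S"
      by (intro add_left_mono sum_mono hitting_approx_mono)
    finally have "(\<Sum>u<n. ?h (Suc T) u) \<le> of_nat n + ?S" .
    moreover have "(\<Sum>u<n. ?h (Suc T) u) = (\<Sum>u\<in>?F. ?h (Suc T) u) + ?S"
      using free_rows_subset by (subst add.commute) (rule sum.subset_diff, auto)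
    ultimately have *: "?S + (\<Sum>u\<in>?F. ?h (Suc T) u) \<le> ?S + of_nat n"
      by (simp add: add.commute)
    \<comment> \<open>\<open>?S\<close> can be cancelled in \<open>ennreal\<close> only because it
      is finite, which the horizon guarantees.\<close>
    have "?S \<le> (\<Sum>u\<in>{..<n} - ?F. of_nat (Suc T))"
      by (intro sum_mono hitting_approx_le[OF m]) auto
    also have "\<dots> < \<infinity>"
      by (simp add: ennreal_mult_less_top of_nat_less_top flip: of_nat_Suc)
    finally have "(\<Sum>u\<in>?F. ?h (Suc T) u) \<le> of_nat n"
      using * by (metis ennreal_add_left_cancel_le less_irrefl)
    moreover have "(\<Sum>u\<in>?F. ?h T u) \<le> (\<Sum>u\<in>?F. ?h (Suc T) u)"
      by (intro sum_mono hitting_approx_mono)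
    ultimately show ?thesis by (rule order_trans[rotated])
  qed
  have "(\<Sum>u\<in>?F. hitting_time n (\<lambda>u v. M $$ (u, v)) m u) = (SUP T. \<Sum>u\<in>?F. ?h T u)"
    unfolding hitting_time_def
    by (intro ennreal_SUP_sum[symmetric] incseq_SucI) (auto intro: hitting_approx_mono simp del: hitting_approx.simps)
  also have "\<dots> \<le> of_nat n" by (intro SUP_least le)
  finally show ?thesis .
qed

end

text \<open>If no row is free, every row \<open>u\<close> is recovered from \<open>\<mu> u\<close>
  by \<open>m\<close>, so \<open>\<mu>\<close> is injective on the rows and hence a bijection. The
  identity outside is imposed by \<open>permutes\<close>.\<close>

lemma perfect_matchingI:
  assumes m: "partial_matching n M m \<mu>" and "free_rows n m = {}"
  shows "perfect_matching n M (\<lambda>u. if u < n then \<mu> u else u)"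
proof -
  have ex: "\<exists>v<n. m v = Suc u \<and> \<mu> u = v \<and> M $$ (u, v) \<noteq> 0" if "u < n" for u
    using that assms unfolding free_rows_def partial_matching_def by blast
  then have "inj_on (\<lambda>u. if u < n then \<mu> u else u) {..<n}"
  proof (intro inj_onI)
    fix u u' assume u: "u \<in> {..<n}" "u' \<in> {..<n}"
      and eq: "(if u < n then \<mu> u else u) = (if u' < n then \<mu> u' else u')"
    obtain v v' where "m v = Suc u" "\<mu> u = v" "m v' = Suc u'" "\<mu> u' = v'"
      using ex[of u] ex[of u'] u by auto
    then show "u = u'" using eq u by simp
  qed
  moreover have "(\<lambda>u. if u < n then \<mu> u else u) ` {..<n} \<subseteq> {..<n}"
    using ex by auto
  ultimately have "bij_betw (\<lambda>u. if u < n then \<mu> u else u) {..<n} {..<n}"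
    unfolding bij_betw_def by (intro conjI endo_inj_surj) auto
  then have "(\<lambda>u. if u < n then \<mu> u else u) permutes {..<n}"
    by (rule bij_imp_permutes) auto
  then show ?thesis
    using ex by (auto simp: perfect_matching_def support_def)
qed

section \<open>Sampling a column\<close>

declare ert.simps(8) [simp del]

lemma nats_set_nat [simp]: "nats (set_nat a i k s) = (nats s)(a := (nats s a)(i := k))"
  and reals_set_nat [simp]: "reals (set_nat a i k s) = reals s"
  and nats_set_real [simp]: "nats (set_real a i x s) = nats s"
  and reals_set_real [simp]: "reals (set_real a i x s) = (reals s)(a := (reals s a)(i := x))"
  by (simp_all add: set_nat_def set_real_def)

text \<open>A frame condition for the arrays of naturals only. The few arrays of reals are followed
  by explicit equations.\<close>

definition unchanged :: "name set \<Rightarrow> memory \<Rightarrow> memory \<Rightarrow> bool" where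
  "unchanged A s s' \<longleftrightarrow> (\<forall>a. a \<notin> A \<longrightarrow> nats s' a = nats s a)"

lemma unchanged_refl [simp]: "unchanged A s s"
  by (simp add: unchanged_def)

lemma unchanged_set_nat: "unchanged A s s' \<Longrightarrow> a \<in> A \<Longrightarrow> unchanged A s (set_nat a i k s')"
  by (auto simp: unchanged_def)

lemma unchanged_set_real: "unchanged A s s' \<Longrightarrow> unchanged A s (set_real a i x s')"
  by (simp add: unchanged_def)

lemma unchanged_trans: "unchanged A s s' \<Longrightarrow> unchanged B s' s'' \<Longrightarrow> B \<subseteq> A \<Longrightarrow> unchanged A s s''"
  by (auto simp: unchanged_def)

lemma unchanged_nats: "unchanged A s s' \<Longrightarrow> a \<notin> A \<Longrightarrow> nats s' a = nats s a"
  by (simp add: unchanged_def)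

abbreviation var :: "name \<Rightarrow> nexp" where
  "var a \<equiv> Nat_Cell a (Lit 0)"

abbreviation assign :: "name \<Rightarrow> nexp \<Rightarrow> com" where
  "assign a e \<equiv> Nat_Assign a (Lit 0) e"

abbreviation seq :: "com \<Rightarrow> com \<Rightarrow> com"  (infixr \<open>;;\<close> 60) where
  "c ;; d \<equiv> Seq c d"

definition search :: com where
  "search = While (Less (var ''lo'') (var ''hi''))
     (assign ''mid'' (Half (Add (var ''lo'') (var ''hi''))) ;;
      If (RLess (Real_Cell ''r'' (Lit 0))
            (Real_Cell ''cum'' (Add (Nat_Cell ''start'' (var ''u'')) (var ''mid''))))
        (assign ''hi'' (var ''mid''))
        (assign ''lo'' (Add (var ''mid'') (Lit 1))))"

text \<open>The cell at offset \<open>k\<close> holds the prefix sum that includes entry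
  \<open>k\<close>, so \<open>j\<close> is the first offset whose cell exceeds \<open>r\<close>. The
  abstract state is an exponent \<open>l\<close> with \<open>hi - lo < 2 ^ l\<close>; an iteration
  lowers it by one and takes four steps: two tests and two assignments.\<close>

lemma ert_search:
  fixes c :: "nat \<Rightarrow> real"
  assumes c: "mono c" "c j \<le> reals s ''r'' 0" "reals s ''r'' 0 < c (Suc j)"
    and cum: "\<And>k. k < d \<Longrightarrow> reals s ''cum'' (nats s ''start'' (nats s ''u'' 0) + k) = c (Suc k)"
    and bounds: "nats s ''lo'' 0 \<le> j" "j \<le> nats s ''hi'' 0" "nats s ''hi'' 0 < d"
      "nats s ''hi'' 0 - nats s ''lo'' 0 < 2 ^ l"
    and f: "\<And>s'. unchanged {''lo'', ''hi'', ''mid''} s s' \<Longrightarrow> reals s' = reals s \<Longrightarrow>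
      nats s' ''lo'' 0 = j \<Longrightarrow> f s' \<le> B"
  shows "ert search f s \<le> of_nat (1 + 4 * l) + B"
proof -
  define I where "I l s' \<longleftrightarrow> unchanged {''lo'', ''hi'', ''mid''} s s' \<and> reals s' = reals s \<and>
    nats s' ''lo'' 0 \<le> j \<and> j \<le> nats s' ''hi'' 0 \<and> nats s' ''hi'' 0 < d \<and>
    nats s' ''hi'' 0 - nats s' ''lo'' 0 < 2 ^ l" for l :: nat and s'
  let ?K = "\<lambda>l. of_nat (1 + 4 * l) + B"
  show ?thesis unfolding search_def
  proof (rule ert_While_le[where I = I and K = ?K])
    show "I l s" using bounds by (simp add: I_def)
  next
    fix l s'
    assume I: "I l s'" and b: "bval (Less (var ''lo'') (var ''hi'')) s'"
    then obtain l' where l: "l = Suc l'" by (cases l) (auto simp: I_def)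
    let ?m = "(nats s' ''lo'' 0 + nats s' ''hi'' 0) div 2"
    let ?s = "set_nat ''mid'' 0 ?m s'"
    have fr: "nats s' ''start'' = nats s ''start''" "nats s' ''u'' = nats s ''u''"
      using I by (simp_all add: I_def unchanged_def)
    have m: "?m < d" using I by (auto simp: I_def)
    have val: "reals s' ''cum'' (nats s' ''start'' (nats s' ''u'' 0) + ?m) = c (Suc ?m)"
      using I cum[OF m] fr by (simp add: I_def)
    have 1: "abstract_cost I ?K (set_nat ''hi'' 0 ?m ?s) \<le> ?K l'"
      if "reals s' ''r'' 0 < c (Suc ?m)"
    proof (rule abstract_cost_le[OF _ order_refl])
      have "j \<le> ?m"
      proof (rule ccontr)
        assume "\<not> j \<le> ?m"
        then have "c (Suc ?m) \<le> c j" by (simp add: monoD[OF c(1)])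
        then show False using that I c(2) by (simp add: I_def)
      qed
      then show "I l' (set_nat ''hi'' 0 ?m ?s)"
        using I b m l by (auto simp: I_def intro!: unchanged_set_nat)
    qed
    have 2: "abstract_cost I ?K (set_nat ''lo'' 0 (?m + 1) ?s) \<le> ?K l'"
      if "\<not> reals s' ''r'' 0 < c (Suc ?m)"
    proof (rule abstract_cost_le[OF _ order_refl])
      have "?m + 1 \<le> j"
      proof (rule ccontr)
        assume "\<not> ?m + 1 \<le> j"
        then have "c (Suc j) \<le> c (Suc ?m)" by (simp add: monoD[OF c(1)])
        then show False using that I c(3) by (simp add: I_def)
      qed
      then show "I l' (set_nat ''lo'' 0 (?m + 1) ?s)"
        using I b m l by (auto simp: I_def intro!: unchanged_set_nat)
    qed
    have 3: "1 + (1 + (1 + (1 + X))) \<le> ?K l" if "X \<le> ?K l'" for X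
    proof -
      have "1 + (1 + (1 + (1 + X))) \<le> 1 + (1 + (1 + (1 + ?K l')))"
        by (intro add_left_mono that)
      also have "\<dots> = ?K l" by (simp add: l algebra_simps)
      finally show ?thesis .
    qed
    show "1 + ert (assign ''mid'' (Half (Add (var ''lo'') (var ''hi''))) ;;
      If (RLess (Real_Cell ''r'' (Lit 0))
            (Real_Cell ''cum'' (Add (Nat_Cell ''start'' (var ''u'')) (var ''mid''))))
        (assign ''hi'' (var ''mid''))
        (assign ''lo'' (Add (var ''mid'') (Lit 1)))) (abstract_cost I ?K) s' \<le> ?K l"
    proof (cases "reals s' ''r'' 0 < c (Suc ?m)")
      case True
      then show ?thesis using 3[OF 1[OF True]] val by simp
    next
      case False
      then show ?thesis using 3[OF 2[OF False]] val by simp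
    qed
  next
    fix l s'
    assume I: "I l s'" and b: "\<not> bval (Less (var ''lo'') (var ''hi'')) s'"
    then have "f s' \<le> B" by (intro f) (auto simp: I_def)
    then show "1 + f s' \<le> ?K l"
      by (simp add: add.assoc add_left_mono add_increasing)
  qed
qed

definition sampling_input :: "nat \<Rightarrow> real mat \<Rightarrow> memory \<Rightarrow> bool" where
  "sampling_input n M s \<longleftrightarrow> (\<forall>u<n. let e = (\<lambda>k. nats s ''row_adj'' (nats s ''row_first'' u + k)) in
     bij_betw e {..<nats s ''row_deg'' u} {v. v < n \<and> M $$ (u, v) \<noteq> 0} \<and>
     (\<forall>k<nats s ''row_deg'' u.
        reals s ''cum'' (nats s ''start'' u + k) = (\<Sum>i<Suc k. M $$ (u, e i))))"

lemma sampling_input_unchanged: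
  assumes "sampling_input n M s" "unchanged A s s'" "reals s' ''cum'' = reals s ''cum''"
    "A \<inter> {''row_adj'', ''row_first'', ''row_deg'', ''start''} = {}"
  shows "sampling_input n M s'"
proof -
  have "nats s' ''row_adj'' = nats s ''row_adj''" "nats s' ''row_first'' = nats s ''row_first''"
    "nats s' ''row_deg'' = nats s ''row_deg''" "nats s' ''start'' = nats s ''start''"
    using assms(2,4) by (simp_all add: unchanged_nats)
  then show ?thesis using assms(1,3) by (simp add: sampling_input_def)
qed

lemma prefix_interval_exists:
  fixes c :: "nat \<Rightarrow> real"
  assumes "c 0 \<le> x" "x < c d"
  shows "\<exists>j<d. c j \<le> x \<and> x < c (Suc j)"
  using assms(2)
proof (induction d)
  case (Suc d)
  then show ?case by (cases "x < c d") (auto intro: less_SucI)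
qed (use assms(1) in simp)

definition sample :: com where
  "sample = Real_Draw ''r'' (Lit 0) (Of_Nat (Lit 0)) (Of_Nat (Lit 1)) ;;
     assign ''lo'' (Lit 0) ;;
     assign ''hi'' (Sub (Nat_Cell ''row_deg'' (var ''u'')) (Lit 1)) ;;
     search"

text \<open>The interval of drawn numbers leading to offset \<open>j\<close> has as its length the
  matrix entry stored there, so column \<open>v\<close> is reached with probability
  \<open>M $$ (u, v)\<close>. The draw, two assignments and the search make up
  \<open>4 + 4 * L\<close>.\<close>

lemma ert_sample:
  assumes ds: "doubly_stochastic n M" and inp: "sampling_input n M s"
    and u: "nats s ''u'' 0 = u" "u < n" and L: "n \<le> 2 ^ L"
    and f: "\<And>s' v. unchanged {''lo'', ''hi'', ''mid''} s s' \<Longrightarrow> reals s' ''cum'' = reals s ''cum'' \<Longrightarrow>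
      nats s' ''row_adj'' (nats s' ''row_first'' u + nats s' ''lo'' 0) = v \<Longrightarrow> v < n \<Longrightarrow>
      M $$ (u, v) \<noteq> 0 \<Longrightarrow> f s' \<le> h v"
  shows "ert sample f s \<le> of_nat (4 + 4 * L) + (\<Sum>v<n. ennreal (M $$ (u, v)) * h v)"
proof -
  define e where "e k = nats s ''row_adj'' (nats s ''row_first'' u + k)" for k
  define d where "d = nats s ''row_deg'' u"
  \<comment> \<open>Continuing by \<open>0\<close> past the degree makes the prefix sums monotone on
    all naturals, as \<open>ert_search\<close> demands.\<close>
  define w where "w k = (if k < d then M $$ (u, e k) else 0)" for k
  define c where "c j = (\<Sum>k<j. w k)" for j
  have bij: "bij_betw e {..<d} {v. v < n \<and> M $$ (u, v) \<noteq> 0}"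
    and cum: "\<And>k. k < d \<Longrightarrow> reals s ''cum'' (nats s ''start'' u + k) = c (Suc k)"
    using inp u(2) by (auto simp: sampling_input_def Let_def e_def[abs_def] d_def c_def w_def)
  have e: "e k < n" "M $$ (u, e k) \<noteq> 0" if "k < d" for k
    using bij_betwE[OF bij] that by blast+
  have sum_e: "(\<Sum>k<d. g (e k)) = (\<Sum>v<n. g v)"
    if "\<And>v. M $$ (u, v) = 0 \<Longrightarrow> g v = 0" for g :: "nat \<Rightarrow> 'a :: comm_monoid_add"
    by (subst sum.reindex_bij_betw[OF bij]) (auto intro!: sum.mono_neutral_left that)
  have w: "0 \<le> w k" for k
    using e entry_nonneg[OF ds u(2)] by (simp add: w_def)
  have mono: "mono c"
    unfolding c_def by (intro monoI sum_mono2) (auto simp: w)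
  \<comment> \<open>As the row sums to \<open>1\<close>, every number drawn from
    \<open>[0,1)\<close> falls into one of the intervals.\<close>
  have c_d: "c d = 1"
  proof -
    have "c d = (\<Sum>k<d. M $$ (u, e k))" by (simp add: c_def w_def)
    also have "\<dots> = (\<Sum>v<n. M $$ (u, v))" by (intro sum_e)
    finally show ?thesis using ds u(2) by (simp add: doubly_stochastic_def)
  qed
  \<comment> \<open>\<open>0 < d\<close> keeps the truncated subtraction in \<open>hi\<close> exact,
    and \<open>d \<le> n\<close> bounds the initial search interval by \<open>2 ^ L\<close>.\<close>
  have d: "0 < d" "d \<le> n"
  proof -
    show "0 < d" using c_d by (cases d) (auto simp: c_def)
    have "d = card {v. v < n \<and> M $$ (u, v) \<noteq> 0}" using bij_betw_same_card[OF bij] by simp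
    also have "\<dots> \<le> card {..<n}" by (intro card_mono) auto
    finally show "d \<le> n" by simp
  qed
  let ?f = "\<lambda>x. ert (assign ''lo'' (Lit 0) ;;
     assign ''hi'' (Sub (Nat_Cell ''row_deg'' (var ''u'')) (Lit 1)) ;; search) f
     (set_real ''r'' 0 x s)"
  have "(\<integral>\<^sup>+x. ?f x \<partial>uniform01) \<le>
    (\<Sum>j<d. ennreal (c (Suc j) - c j) * (of_nat (3 + 4 * L) + h (e j)))"
  proof (rule nn_integral_uniform01_le)
    fix x :: real assume x: "0 \<le> x" "x < 1"
    have "c 0 \<le> x" "x < c d" using x c_d by (auto simp: c_def)
    from prefix_interval_exists[of c, OF this]
    obtain j where j: "j < d" "c j \<le> x" "x < c (Suc j)" by auto
    let ?s = "set_nat ''hi'' 0 (d - 1) (set_nat ''lo'' 0 0 (set_real ''r'' 0 x s))"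
    have us: "unchanged {''lo'', ''hi'', ''mid''} s ?s"
      by (intro unchanged_set_nat unchanged_set_real) auto
    have "ert search f ?s \<le> of_nat (1 + 4 * L) + h (e j)"
    proof (rule ert_search[where c = c and d = d and j = j])
      show "mono c" by (rule mono)
      show "nats ?s ''hi'' 0 - nats ?s ''lo'' 0 < 2 ^ L" using d L by simp
      fix s' assume s': "unchanged {''lo'', ''hi'', ''mid''} ?s s'" "reals s' = reals ?s"
        "nats s' ''lo'' 0 = j"
      have us': "unchanged {''lo'', ''hi'', ''mid''} s s'"
        by (rule unchanged_trans[OF us s'(1)]) auto
      have "nats s' ''row_adj'' = nats s ''row_adj''" "nats s' ''row_first'' = nats s ''row_first''"
        using us' by (simp_all add: unchanged_def)
      then show "f s' \<le> h (e j)"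
        using s' us' e[OF j(1)] by (intro f) (auto simp: e_def)
    qed (use j d u cum in auto)
    then have "1 + (1 + ert search f ?s) \<le> 1 + (1 + (of_nat (1 + 4 * L) + h (e j)))"
      by (intro add_left_mono)
    also have "\<dots> = of_nat (3 + 4 * L) + h (e j)" by (simp add: algebra_simps)
    finally have "?f x \<le> of_nat (3 + 4 * L) + h (e j)"
      using u by (simp add: d_def)
    then show "\<exists>j<d. c j \<le> x \<and> x < c (Suc j) \<and> ?f x \<le> of_nat (3 + 4 * L) + h (e j)"
      using j by auto
  qed (use mono in \<open>auto simp: mono_def\<close>)
  also have "\<dots> = (\<Sum>j<d. ennreal (M $$ (u, e j)) * (of_nat (3 + 4 * L) + h (e j)))"
    by (intro sum.cong) (auto simp: c_def w_def)
  also have "\<dots> = (\<Sum>v<n. ennreal (M $$ (u, v)) * (of_nat (3 + 4 * L) + h v))"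
    by (intro sum_e) simp
  also have "\<dots> = of_nat (3 + 4 * L) + (\<Sum>v<n. ennreal (M $$ (u, v)) * h v)"
    using row_sum[OF ds u(2)]
    by (simp add: distrib_left sum.distrib flip: sum_distrib_right)
  finally have "1 + (\<integral>\<^sup>+x. ?f x \<partial>uniform01) \<le>
      1 + (of_nat (3 + 4 * L) + (\<Sum>v<n. ennreal (M $$ (u, v)) * h v))"
    by (rule add_left_mono)
  also have "\<dots> = of_nat (4 + 4 * L) + (\<Sum>v<n. ennreal (M $$ (u, v)) * h v)"
    by (simp add: algebra_simps)
  finally show ?thesis by (simp add: sample_def)
qed

section \<open>Walking and augmenting\<close>

definition walk :: com where
  "walk = While (Less (Lit 0) (var ''w''))
     (assign ''u'' (Sub (var ''w'') (Lit 1)) ;;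
      sample ;;
      assign ''v'' (Nat_Cell ''row_adj''
        (Add (Nat_Cell ''row_first'' (var ''u'')) (var ''lo''))) ;;
      Nat_Assign ''next'' (var ''u'') (var ''v'') ;;
      assign ''w'' (Nat_Cell ''mate'' (var ''v'')))"

text \<open>
  \<open>trail n M m nx xs w w'\<close>: alternating the pointers \<open>nx\<close> from rows to columns with the matching \<open>m\<close>
  from columns to rows leads from \<open>w\<close> to \<open>w'\<close> through the rows \<open>xs\<close>. Rows are encoded as in \<open>m\<close>,
  so that \<open>w' = 0\<close> means that a free column has been reached.
\<close>

fun trail :: "nat \<Rightarrow> real mat \<Rightarrow> (nat \<Rightarrow> nat) \<Rightarrow> (nat \<Rightarrow> nat) \<Rightarrow> nat list \<Rightarrow> nat \<Rightarrow> nat \<Rightarrow> bool" where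
  "trail n M m nx [] w w' \<longleftrightarrow> w = w'"
| "trail n M m nx (x # xs) w w' \<longleftrightarrow>
     w = Suc x \<and> nx x < n \<and> M $$ (x, nx x) \<noteq> 0 \<and> trail n M m nx xs (m (nx x)) w'"

lemma trail_append:
  "trail n M m nx (xs @ ys) w w'' \<longleftrightarrow> (\<exists>w'. trail n M m nx xs w w' \<and> trail n M m nx ys w' w'')"
  by (induction xs arbitrary: w) auto

text \<open>The next row is determined by the pointers, and no row is encoded as \<open>0\<close>.
  Consequently a trail that ends at a free column cannot use a column twice: from there two trails
  of different lengths would start.\<close>

lemma trail_unique:
  "trail n M m nx xs w 0 \<Longrightarrow> trail n M m nx ys w 0 \<Longrightarrow> xs = ys"
proof (induction xs arbitrary: w ys)
  case Nil
  then show ?case by (cases ys) auto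
next
  case (Cons x xs)
  then show ?case by (cases ys) auto
qed

lemma trail_cong:
  "(\<And>x. x \<in> set xs \<Longrightarrow> nx' x = nx x \<and> m' (nx x) = m (nx x)) \<Longrightarrow>
    trail n M m' nx' xs w w' \<longleftrightarrow> trail n M m nx xs w w'"
  by (induction xs arbitrary: w) auto

text \<open>A row that is visited again cuts off the loop that the trail has made since its last visit.\<close>

lemma trail_step:
  assumes "trail n M m nx xs w (Suc u)" "u \<notin> set xs" "v < n" "M $$ (u, v) \<noteq> 0"
  shows "\<exists>ys. trail n M m (nx(u := v)) ys w (m v) \<and> length ys \<le> Suc (length xs) \<and>
    (\<forall>u'. m v = Suc u' \<longrightarrow> u' \<notin> set ys)"
proof -
  let ?nx = "nx(u := v)"
  have "trail n M m ?nx xs w (Suc u)"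
    using assms(1,2) by (subst trail_cong[where nx = nx and m = m]) auto
  then have xs: "trail n M m ?nx (xs @ [u]) w (m v)"
    using assms(3,4) by (auto simp: trail_append)
  show ?thesis
  proof (cases "\<exists>u'. m v = Suc u' \<and> u' \<in> set (xs @ [u])")
    case False
    then show ?thesis using xs by (intro exI[of _ "xs @ [u]"]) auto
  next
    case True
    then obtain u' where u': "m v = Suc u'" "u' \<in> set (xs @ [u])" by blast
    \<comment> \<open>Cutting before the first occurrence keeps \<open>u'\<close> off the new trail.
      The case \<open>u' = u\<close> is included: if the sampled column is matched to
      \<open>u\<close> itself, the trail just stays as it was.\<close>
    from split_list_first[OF u'(2)] obtain ys zs where
      split: "xs @ [u] = ys @ u' # zs" "u' \<notin> set ys" by blast
    have "trail n M m ?nx ys w (m v)"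
      using xs u'(1) unfolding split(1) trail_append by auto
    moreover have "length ys \<le> Suc (length xs)"
      using arg_cong[OF split(1), of length] by simp
    ultimately show ?thesis using split(2) u'(1) by auto
  qed
qed

text \<open>Amortisation: a step of the walk costs \<open>9 + 4 * L\<close> (test, four assignments,
  sampling) and sets aside \<open>6\<close> more for the row it may add to the trail, hence
  \<open>15 + 4 * L\<close>. The savings \<open>6 * length xs\<close> later pay for augmenting along
  the trail, so its length never enters the bound; rows cut off in a loop forfeit theirs.\<close>

lemma ert_walk:
  assumes ds: "doubly_stochastic n M" and inp: "sampling_input n M s" and L: "n \<le> 2 ^ L"
    and m: "partial_matching n M (nats s ''mate'') \<mu>"
    and u0: "nats s ''w'' 0 = Suc u0" "u0 < n"
    and f: "\<And>s' xs. unchanged {''lo'', ''hi'', ''mid'', ''u'', ''v'', ''w'', ''next''} s s' \<Longrightarrow>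
      reals s' ''cum'' = reals s ''cum'' \<Longrightarrow> nats s' ''w'' 0 = 0 \<Longrightarrow>
      trail n M (nats s ''mate'') (nats s' ''next'') xs (Suc u0) 0 \<Longrightarrow>
      f s' \<le> of_nat (6 * length xs) + B"
  shows "ert walk f s \<le>
    1 + of_nat (15 + 4 * L) * hitting_time n (\<lambda>u v. M $$ (u, v)) (nats s ''mate'') u0 + B"
proof -
  let ?A = "{''lo'', ''hi'', ''mid'', ''u'', ''v'', ''w'', ''next''}"
  let ?m = "nats s ''mate''"
  let ?H = "hitting_time n (\<lambda>u v. M $$ (u, v)) ?m"
  \<comment> \<open>The current row is kept off the trail \<open>xs\<close>, so redirecting its
    pointer in \<open>next\<close> leaves the trail intact. Stale pointers of rows off the trail are
    harmless.\<close>
  define I where "I g s' \<longleftrightarrow> (case g of (xs, w) \<Rightarrow>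
    unchanged ?A s s' \<and> reals s' ''cum'' = reals s ''cum'' \<and> nats s' ''w'' 0 = w \<and>
    trail n M ?m (nats s' ''next'') xs (Suc u0) w \<and> (\<forall>u. w = Suc u \<longrightarrow> u < n \<and> u \<notin> set xs))"
    for g :: "nat list \<times> nat" and s'
  define K where "K g = (case g of (xs, w) \<Rightarrow>
    1 + of_nat (15 + 4 * L) * (case w of 0 \<Rightarrow> 0 | Suc u \<Rightarrow> ?H u) + (of_nat (6 * length xs) + B))"
    for g :: "nat list \<times> nat"
  have "ert walk f s \<le> K ([], Suc u0)"
    unfolding walk_def
  proof (rule ert_While_le[where I = I and K = K])
    show "I ([], Suc u0) s" using u0 by (simp add: I_def)
  next
    fix g s' assume I: "I g s'" and b: "bval (Less (Lit 0) (var ''w'')) s'"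
    obtain xs w where g: "g = (xs, w)" by force
    obtain u where w: "w = Suc u" using I b by (cases w) (auto simp: I_def g)
    have s': "unchanged ?A s s'" "reals s' ''cum'' = reals s ''cum''" "nats s' ''w'' 0 = Suc u"
      and tr: "trail n M ?m (nats s' ''next'') xs (Suc u0) (Suc u)" and u: "u < n" "u \<notin> set xs"
      using I by (auto simp: I_def g w)
    let ?su = "set_nat ''u'' 0 u s'"
    have su: "unchanged ?A s ?su" by (intro unchanged_set_nat s') auto
    let ?B = "of_nat (6 * Suc (length xs)) + B"
    let ?h = "\<lambda>v. 3 + (1 + of_nat (15 + 4 * L) * (case ?m v of 0 \<Rightarrow> 0 | Suc u \<Rightarrow> ?H u) + ?B)"
    let ?f = "ert (assign ''v'' (Nat_Cell ''row_adj''
        (Add (Nat_Cell ''row_first'' (var ''u'')) (var ''lo''))) ;;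
      Nat_Assign ''next'' (var ''u'') (var ''v'') ;;
      assign ''w'' (Nat_Cell ''mate'' (var ''v''))) (abstract_cost I K)"
    have "ert sample ?f ?su \<le> of_nat (4 + 4 * L) + (\<Sum>v<n. ennreal (M $$ (u, v)) * ?h v)"
    proof (rule ert_sample[OF ds _ _ u(1) L])
      show "sampling_input n M ?su"
        by (rule sampling_input_unchanged[OF inp su]) (use s' in auto)
      show "nats ?su ''u'' 0 = u" by simp
    next
      fix t v
      assume t: "unchanged {''lo'', ''hi'', ''mid''} ?su t" "reals t ''cum'' = reals ?su ''cum''"
        and v: "nats t ''row_adj'' (nats t ''row_first'' u + nats t ''lo'' 0) = v" "v < n"
          "M $$ (u, v) \<noteq> 0"
      have st: "unchanged ?A s t" by (rule unchanged_trans[OF su t(1)]) auto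
      have eq: "nats t ''u'' 0 = u" "nats t ''next'' = nats s' ''next''" "nats t ''mate'' = ?m"
        using t(1) st by (simp_all add: unchanged_def)
      from trail_step[OF tr u(2) v(2,3)] obtain ys where
        ys: "trail n M ?m ((nats s' ''next'')(u := v)) ys (Suc u0) (?m v)"
          "length ys \<le> Suc (length xs)" "\<And>u'. ?m v = Suc u' \<Longrightarrow> u' \<notin> set ys" by auto
      let ?t = "set_nat ''w'' 0 (?m v) (set_nat ''next'' u v (set_nat ''v'' 0 v t))"
      have "I (ys, ?m v) ?t"
        unfolding I_def prod.case
      proof (intro conjI)
        show "unchanged ?A s ?t" by (intro unchanged_set_nat st) auto
        show "\<forall>u'. ?m v = Suc u' \<longrightarrow> u' < n \<and> u' \<notin> set ys"
          using ys(3) m v(2) by (auto simp: partial_matching_def)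
      qed (use s' t ys eq in auto)
      then have "abstract_cost I K ?t \<le>
          1 + of_nat (15 + 4 * L) * (case ?m v of 0 \<Rightarrow> 0 | Suc u \<Rightarrow> ?H u) + ?B"
      proof (rule abstract_cost_le)
        show "K (ys, ?m v) \<le>
          1 + of_nat (15 + 4 * L) * (case ?m v of 0 \<Rightarrow> 0 | Suc u \<Rightarrow> ?H u) + ?B"
          unfolding K_def prod.case using ys(2)
          by (intro add_left_mono add_right_mono) (simp only: of_nat_le_iff, simp)
      qed
      then have "3 + abstract_cost I K ?t \<le> ?h v"
        by (rule add_left_mono)
      also have "3 + abstract_cost I K ?t = 1 + (1 + (1 + abstract_cost I K ?t))"
        by (simp flip: add.assoc)
      finally show "?f t \<le> ?h v"
        using eq v(1) by simp
    qed
    also have "(\<Sum>v<n. ennreal (M $$ (u, v)) * ?h v) =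
        (4 + ?B) + of_nat (15 + 4 * L) *
        (\<Sum>v<n. ennreal (M $$ (u, v)) * (case ?m v of 0 \<Rightarrow> 0 | Suc u \<Rightarrow> ?H u))"
    proof -
      have "(\<Sum>v<n. ennreal (M $$ (u, v)) * ?h v) = (\<Sum>v<n. ennreal (M $$ (u, v)) * (4 + ?B) +
        of_nat (15 + 4 * L) * (ennreal (M $$ (u, v)) * (case ?m v of 0 \<Rightarrow> 0 | Suc u \<Rightarrow> ?H u)))"
      proof (intro sum.cong refl)
        fix v
        have "p * (3 + (1 + a * x + y)) = p * (4 + y) + a * (p * x)" for p a x y :: ennreal
        proof -
          have "3 + (1 + a * x + y) = (3 + 1) + y + a * x" by (simp only: ac_simps)
          also have "\<dots> = 4 + y + a * x" by simp
          finally show ?thesis by (simp only: distrib_left mult.left_commute)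
        qed
        then show "ennreal (M $$ (u, v)) * ?h v = ennreal (M $$ (u, v)) * (4 + ?B) +
          of_nat (15 + 4 * L) * (ennreal (M $$ (u, v)) * (case ?m v of 0 \<Rightarrow> 0 | Suc u \<Rightarrow> ?H u))" .
      qed
      then show ?thesis
        using row_sum[OF ds u(1)] by (simp add: sum.distrib flip: sum_distrib_left sum_distrib_right)
    qed
    finally have "1 + (1 + ert sample ?f ?su) \<le> 1 + (1 + (of_nat (4 + 4 * L) + ((4 + ?B) +
        of_nat (15 + 4 * L) *
        (\<Sum>v<n. ennreal (M $$ (u, v)) * (case ?m v of 0 \<Rightarrow> 0 | Suc u \<Rightarrow> ?H u)))))"
      by (intro add_left_mono)
    also have "\<dots> = 1 + of_nat (15 + 4 * L) *
        (1 + (\<Sum>v<n. ennreal (M $$ (u, v)) * (case ?m v of 0 \<Rightarrow> 0 | Suc u \<Rightarrow> ?H u))) +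
        (of_nat (6 * length xs) + B)"
      by (simp add: algebra_simps)
    also have "\<dots> \<le> K g"
      unfolding K_def g prod.case w nat.case
      by (intro add_left_mono add_right_mono mult_left_mono hitting_time_step) simp
    finally show "1 + ert (assign ''u'' (Sub (var ''w'') (Lit 1)) ;;
      sample ;;
      assign ''v'' (Nat_Cell ''row_adj''
        (Add (Nat_Cell ''row_first'' (var ''u'')) (var ''lo''))) ;;
      Nat_Assign ''next'' (var ''u'') (var ''v'') ;;
      assign ''w'' (Nat_Cell ''mate'' (var ''v''))) (abstract_cost I K) s' \<le> K g"
      using s'(3) by simp
  next
    fix g s' assume I: "I g s'" and b: "\<not> bval (Less (Lit 0) (var ''w'')) s'"
    obtain xs w where g: "g = (xs, w)" by force
    have w: "w = 0" using I b by (simp add: I_def g)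
    have "f s' \<le> of_nat (6 * length xs) + B"
      using I by (intro f) (auto simp: I_def g w)
    then show "1 + f s' \<le> K g"
      by (simp add: K_def g w add_left_mono)
  qed
  then show ?thesis by (simp add: K_def)
qed

definition augment :: com where
  "augment = While (Less (Lit 0) (var ''w''))
     (assign ''u'' (Sub (var ''w'') (Lit 1)) ;;
      assign ''v'' (Nat_Cell ''next'' (var ''u'')) ;;
      assign ''w'' (Nat_Cell ''mate'' (var ''v'')) ;;
      Nat_Assign ''mate'' (var ''v'') (Add (var ''u'') (Lit 1)) ;;
      Nat_Assign ''matching'' (var ''u'') (var ''v''))"

text \<open>One exchange passes the vacancy on: \<open>x\<close> takes over \<open>v\<close>, and
  the former mate of \<open>v\<close>, if any, becomes free in its place. That row keeps a stale
  value in \<open>\<mu>\<close>, which \<open>partial_matching\<close> tolerates because no column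
  names it as mate any more.\<close>

lemma rematch:
  assumes m: "partial_matching n M m \<mu>" and x: "x \<in> free_rows n m"
    and v: "v < n" "M $$ (x, v) \<noteq> 0"
  shows "partial_matching n M (m(v := Suc x)) (\<mu>(x := v))"
    and "m v = 0 \<Longrightarrow> free_rows n (m(v := Suc x)) = free_rows n m - {x}"
    and "m v = Suc u \<Longrightarrow> u \<in> free_rows n (m(v := Suc x))"
    and "m v = Suc u \<Longrightarrow> free_rows n (m(v := Suc x)) - {u} = free_rows n m - {x}"
proof -
  have x': "x < n" "\<And>v'. v' < n \<Longrightarrow> m v' \<noteq> Suc x"
    using x unfolding free_rows_def by blast+
  then show "partial_matching n M (m(v := Suc x)) (\<mu>(x := v))"
    using m v unfolding partial_matching_def by simp
  have F: "u \<in> free_rows n (m(v := Suc x)) \<longleftrightarrow> u < n \<and> u \<noteq> x \<and> (\<forall>v'<n. v' \<noteq> v \<longrightarrow> m v' \<noteq> Suc u)" for u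
  proof -
    have "(\<forall>v'<n. (m(v := Suc x)) v' \<noteq> Suc u) \<longleftrightarrow>
      (m(v := Suc x)) v \<noteq> Suc u \<and> (\<forall>v'<n. v' \<noteq> v \<longrightarrow> (m(v := Suc x)) v' \<noteq> Suc u)"
      using v(1) by blast
    then show ?thesis by (auto simp: free_rows_def)
  qed
  have F': "u \<in> free_rows n m \<longleftrightarrow> u < n \<and> m v \<noteq> Suc u \<and> (\<forall>v'<n. v' \<noteq> v \<longrightarrow> m v' \<noteq> Suc u)" for u
    using v(1) unfolding free_rows_def by blast
  show "free_rows n (m(v := Suc x)) = free_rows n m - {x}" if "m v = 0"
    by (rule Set.set_eqI) (unfold Diff_iff F F' that, blast)
  assume u: "m v = Suc u"
  then have un: "u < n" "u \<noteq> x" "\<And>v'. v' < n \<Longrightarrow> m v' = Suc u \<Longrightarrow> v' = v"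
    using m v(1) x'(2) partial_matching_inj[OF m] unfolding partial_matching_def by metis+
  then show "u \<in> free_rows n (m(v := Suc x))"
    unfolding F by blast
  show "free_rows n (m(v := Suc x)) - {u} = free_rows n m - {x}"
    by (rule Set.set_eqI) (unfold Diff_iff F F' u nat.inject, use un x' in blast)
qed

text \<open>The memory holds a valid partial matching after every iteration. Up to one row, the
  vacancy being passed along, the set of free rows is already the final one. The vacancy disappears
  when the free column is reached. A row of the trail costs a test and five assignments.\<close>

lemma ert_augment:
  assumes m: "partial_matching n M (nats s ''mate'') (nats s ''matching'')"
    and u0: "nats s ''w'' 0 = Suc u0" "u0 \<in> free_rows n (nats s ''mate'')"
    and xs: "trail n M (nats s ''mate'') (nats s ''next'') xs (Suc u0) 0"
    and f: "\<And>s'. unchanged {''u'', ''v'', ''w'', ''mate'', ''matching''} s s' \<Longrightarrow>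
      reals s' = reals s \<Longrightarrow> partial_matching n M (nats s' ''mate'') (nats s' ''matching'') \<Longrightarrow>
      free_rows n (nats s' ''mate'') = free_rows n (nats s ''mate'') - {u0} \<Longrightarrow> f s' \<le> B"
  shows "ert augment f s \<le> of_nat (1 + 6 * length xs) + B"
proof -
  let ?A = "{''u'', ''v'', ''w'', ''mate'', ''matching''}"
  let ?F = "free_rows n (nats s ''mate'') - {u0}"
  define I where "I xs s' \<longleftrightarrow> unchanged ?A s s' \<and> reals s' = reals s \<and>
    partial_matching n M (nats s' ''mate'') (nats s' ''matching'') \<and>
    trail n M (nats s' ''mate'') (nats s' ''next'') xs (nats s' ''w'' 0) 0 \<and>
    (case nats s' ''w'' 0 of 0 \<Rightarrow> free_rows n (nats s' ''mate'') = ?F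
      | Suc x \<Rightarrow> x \<in> free_rows n (nats s' ''mate'') \<and> free_rows n (nats s' ''mate'') - {x} = ?F)"
    for xs s'
  let ?K = "\<lambda>xs. of_nat (1 + 6 * length xs) + B"
  show ?thesis
    unfolding augment_def
  proof (rule ert_While_le[where I = I and K = ?K])
    show "I xs s" using assms by (simp add: I_def)
  next
    fix xs s' assume I: "I xs s'" and b: "bval (Less (Lit 0) (var ''w'')) s'"
    then obtain x where w: "nats s' ''w'' 0 = Suc x" by (cases "nats s' ''w'' 0") auto
    let ?m = "nats s' ''mate''" and ?nx = "nats s' ''next''" and ?\<mu> = "nats s' ''matching''"
    have s': "unchanged ?A s s'" "reals s' = reals s" and pm: "partial_matching n M ?m ?\<mu>"
      and tr: "trail n M ?m ?nx xs (Suc x) 0"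
      and x: "x \<in> free_rows n ?m" "free_rows n ?m - {x} = ?F"
      using I by (simp_all add: I_def w)
    from tr obtain ys where xs: "xs = x # ys" by (cases xs) auto
    let ?v = "?nx x"
    have v: "?v < n" "M $$ (x, ?v) \<noteq> 0" and ys: "trail n M ?m ?nx ys (?m ?v) 0"
      using tr by (simp_all add: xs)
    \<comment> \<open>No later row of the trail points to the column being rematched; otherwise the
      part after that row and all of \<open>ys\<close> would be two trails from the same mate,
      contrary to \<open>trail_unique\<close>. Hence overwriting the mate of \<open>?v\<close>
      leaves the rest of the trail valid.\<close>
    have "?nx y \<noteq> ?v" if "y \<in> set ys" for y
    proof
      assume y: "?nx y = ?v"
      from split_list[OF that] obtain as bs where split: "ys = as @ y # bs" by blast
      have "trail n M ?m ?nx bs (?m ?v) 0"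
        using ys y by (auto simp: split trail_append)
      from arg_cong[OF trail_unique[OF ys this], of length] show False by (simp add: split)
    qed
    then have ys': "trail n M (?m(?v := Suc x)) ?nx ys (?m ?v) 0"
      using ys by (subst trail_cong[where nx = ?nx and m = ?m]) auto
    let ?t = "set_nat ''matching'' x ?v (set_nat ''mate'' ?v (Suc x) (set_nat ''w'' 0 (?m ?v)
      (set_nat ''v'' 0 ?v (set_nat ''u'' 0 x s'))))"
    have "I ys ?t"
      unfolding I_def
    proof (intro conjI)
      show "unchanged ?A s ?t" by (intro unchanged_set_nat s') auto
      show "case nats ?t ''w'' 0 of 0 \<Rightarrow> free_rows n (nats ?t ''mate'') = ?F
        | Suc x \<Rightarrow> x \<in> free_rows n (nats ?t ''mate'') \<and> free_rows n (nats ?t ''mate'') - {x} = ?F"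
        using rematch(2-4)[OF pm x(1) v] x(2) by (auto split: nat.split)
    qed (use rematch(1)[OF pm x(1) v] s' ys' in auto)
    then have "abstract_cost I ?K ?t \<le> ?K ys"
      by (rule abstract_cost_le) simp
    then have "1 + (1 + (1 + (1 + (1 + (1 + abstract_cost I ?K ?t)))))
        \<le> 1 + (1 + (1 + (1 + (1 + (1 + ?K ys)))))"
      by (intro add_left_mono)
    also have "\<dots> = ?K xs" by (simp add: xs algebra_simps)
    finally show "1 + ert (assign ''u'' (Sub (var ''w'') (Lit 1)) ;;
      assign ''v'' (Nat_Cell ''next'' (var ''u'')) ;;
      assign ''w'' (Nat_Cell ''mate'' (var ''v'')) ;;
      Nat_Assign ''mate'' (var ''v'') (Add (var ''u'') (Lit 1)) ;;
      Nat_Assign ''matching'' (var ''u'') (var ''v'')) (abstract_cost I ?K) s' \<le> ?K xs"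
      using w by simp
  next
    fix xs s' assume I: "I xs s'" and b: "\<not> bval (Less (Lit 0) (var ''w'')) s'"
    then have "f s' \<le> B" by (intro f) (auto simp: I_def)
    then show "1 + f s' \<le> ?K xs"
      by (simp add: add.assoc add_left_mono add_increasing)
  qed
qed

section \<open>The main loop\<close>

definition find_matching :: com where
  "find_matching = While (Less (Lit 0) (var ''size''))
     (Nat_Draw ''i'' (Lit 0) (var ''size'') ;;
      assign ''w'' (Add (Nat_Cell ''free'' (var ''i'')) (Lit 1)) ;;
      assign ''root'' (var ''w'') ;;
      walk ;;
      assign ''w'' (var ''root'') ;;
      augment ;;
      assign ''size'' (Sub (var ''size'') (Lit 1)) ;;
      Nat_Assign ''free'' (var ''i'') (Nat_Cell ''free'' (var ''size'')))"

text \<open>Deletion in constant time: the last element fills the gap, so the free rows stay packed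
  in an initial segment. The case \<open>i = k\<close> simply drops the last element.\<close>

lemma swap_remove:
  assumes "inj_on g {..<Suc k}" "i \<le> k"
  shows "inj_on (g(i := g k)) {..<k}"
    and "(g(i := g k)) ` {..<k} = g ` {..<Suc k} - {g i}"
proof -
  have inj: "\<And>a b. a \<le> k \<Longrightarrow> b \<le> k \<Longrightarrow> g a = g b \<Longrightarrow> a = b"
    using assms(1) by (auto simp: inj_on_def)
  show "inj_on (g(i := g k)) {..<k}"
  proof (rule inj_onI)
    fix a b assume "a \<in> {..<k}" "b \<in> {..<k}" "(g(i := g k)) a = (g(i := g k)) b"
    then show "a = b"
      using inj[of k a] inj[of k b] inj[of a k] inj[of a b]
      by (cases "a = i"; cases "b = i") auto
  qed
  show "(g(i := g k)) ` {..<k} = g ` {..<Suc k} - {g i}"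
  proof
    show "(g(i := g k)) ` {..<k} \<subseteq> g ` {..<Suc k} - {g i}"
    proof
      fix y assume "y \<in> (g(i := g k)) ` {..<k}"
      then obtain a where a: "a < k" "y = (g(i := g k)) a" by blast
      show "y \<in> g ` {..<Suc k} - {g i}"
      proof (cases "a = i")
        case True
        then have "g k \<noteq> g i" using inj[of k i] a(1) by auto
        then show ?thesis using True a by auto
      next
        case False
        then have "g a \<noteq> g i" using inj[of a i] a(1) assms(2) by auto
        then show ?thesis using False a by auto
      qed
    qed
    show "g ` {..<Suc k} - {g i} \<subseteq> (g(i := g k)) ` {..<k}"
    proof
      fix y assume "y \<in> g ` {..<Suc k} - {g i}"
      then obtain a where a: "a < Suc k" "y = g a" "a \<noteq> i" by blast
      show "y \<in> (g(i := g k)) ` {..<k}"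
      proof (cases "a = k")
        case True
        then have "y = (g(i := g k)) i" "i < k" using a assms(2) by auto
        then show ?thesis by blast
      next
        case False
        then have "y = (g(i := g k)) a" "a < k" using a by auto
        then show ?thesis by blast
      qed
    qed
  qed
qed

lemma nn_integral_uniform01_nat_le:
  fixes f :: "nat \<Rightarrow> ennreal"
  assumes k: "0 < k"
  shows "(\<integral>\<^sup>+x. f (nat \<lfloor>x * real k\<rfloor>) \<partial>uniform01) \<le> (\<Sum>i<k. ennreal (1 / k) * f i)"
proof -
  have "(\<integral>\<^sup>+x. f (nat \<lfloor>x * real k\<rfloor>) \<partial>uniform01) \<le>
    (\<Sum>i<k. ennreal (real (Suc i) / k - real i / k) * f i)"
  proof (rule nn_integral_uniform01_le)
    fix x :: real assume x: "0 \<le> x" "x < 1"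
    let ?i = "nat \<lfloor>x * real k\<rfloor>"
    have i: "real ?i \<le> x * k" "x * k < real ?i + 1"
      using x by (auto simp: of_nat_nat)
    have "x * k < 1 * real k" using x k by (intro mult_strict_right_mono) auto
    then have "?i < k" using i by linarith
    moreover have "real ?i / k \<le> x" "x < real (Suc ?i) / k"
      using i k by (simp_all add: field_simps)
    ultimately show "\<exists>j<k. real j / k \<le> x \<and> x < real (Suc j) / k \<and> f ?i \<le> f j"
      by blast
  qed (use k in \<open>simp add: field_simps\<close>)
  also have "\<dots> = (\<Sum>i<k. ennreal (1 / k) * f i)"
    using k by (intro sum.cong refl) (simp add: field_simps)
  finally show ?thesis .
qed

text \<open>Both the postcondition of the preprocessing and the invariant of the main loop.
  Injectivity of \<open>free\<close> turns a uniform index into a uniform free row.\<close>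

definition prepared :: "nat \<Rightarrow> real mat \<Rightarrow> nat \<Rightarrow> memory \<Rightarrow> bool" where
  "prepared n M k s \<longleftrightarrow> sampling_input n M s \<and>
     partial_matching n M (nats s ''mate'') (nats s ''matching'') \<and> nats s ''size'' 0 = k \<and>
     inj_on (nats s ''free'') {..<k} \<and> nats s ''free'' ` {..<k} = free_rows n (nats s ''mate'')"

text \<open>The summand for \<open>j\<close> is the round with \<open>j + 1\<close> free rows, where
  the average hitting time is at most \<open>n / Suc j\<close>. The overhead \<open>9\<close> of a
  round consists of the loop test, the draw, the final tests of \<open>walk\<close> and
  \<open>augment\<close>, and five assignments.\<close>

lemma ert_find_matching:
  assumes ds: "doubly_stochastic n M" and L: "n \<le> 2 ^ L" and s: "prepared n M k s"
  shows "ert find_matching (\<lambda>s. if matching_output n M s then 0 else \<infinity>) s \<le>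
    1 + (\<Sum>j<k. 9 + of_nat (15 + 4 * L) * ennreal (n / Suc j))"
proof -
  let ?f = "\<lambda>s. if matching_output n M s then 0 else \<infinity> :: ennreal"
  let ?c = "of_nat (15 + 4 * L) :: ennreal"
  let ?K = "\<lambda>k. 1 + (\<Sum>j<k. 9 + ?c * ennreal (n / Suc j))"
  let ?W = "{''lo'', ''hi'', ''mid'', ''u'', ''v'', ''w'', ''next''}"
  show ?thesis
    unfolding find_matching_def
  proof (rule ert_While_le[where I = "prepared n M" and K = ?K])
    show "prepared n M k s" by (rule s)
  next
    fix k s assume s: "prepared n M k s" and b: "bval (Less (Lit 0) (var ''size'')) s"
    then obtain k' where k: "k = Suc k'" by (cases k) (auto simp: prepared_def)
    let ?m = "nats s ''mate''" and ?g = "nats s ''free''"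
    let ?H = "hitting_time n (\<lambda>u v. M $$ (u, v)) ?m"
    have inp: "sampling_input n M s" and pm: "partial_matching n M ?m (nats s ''matching'')"
      and size: "nats s ''size'' 0 = Suc k'" and inj: "inj_on ?g {..<Suc k'}"
      and img: "?g ` {..<Suc k'} = free_rows n ?m"
      using s by (auto simp: prepared_def k)
    let ?f8 = "ert (assign ''size'' (Sub (var ''size'') (Lit 1)) ;;
      Nat_Assign ''free'' (var ''i'') (Nat_Cell ''free'' (var ''size'')))
      (abstract_cost (prepared n M) ?K)"
    let ?f5 = "ert (assign ''w'' (var ''root'') ;; augment) ?f8"
    let ?f1 = "ert (assign ''w'' (Add (Nat_Cell ''free'' (var ''i'')) (Lit 1)) ;;
      assign ''root'' (var ''w'') ;; walk) ?f5"
    \<comment> \<open>The \<open>7\<close> is the overhead of a round without its loop test and its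
      draw.\<close>
    have round: "?f1 (set_nat ''i'' 0 i s) \<le> 7 + ?K k' + ?c * ?H (?g i)" if i: "i < k" for i
    proof -
      let ?u = "?g i"
      have u: "?u \<in> free_rows n ?m" "?u < n"
        using i img free_rows_subset[of n ?m] by (auto simp: k)
      let ?s = "set_nat ''root'' 0 (Suc ?u) (set_nat ''w'' 0 (Suc ?u) (set_nat ''i'' 0 i s))"
      have us: "unchanged {''root'', ''w'', ''i''} s ?s"
        by (intro unchanged_set_nat unchanged_refl) auto
      have "ert walk ?f5 ?s \<le> 1 + ?c * hitting_time n (\<lambda>u v. M $$ (u, v)) (nats ?s ''mate'') ?u
        + (4 + ?K k')"
      proof (rule ert_walk[OF ds _ L])
        show "sampling_input n M ?s"
          by (rule sampling_input_unchanged[OF inp us]) auto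
        show "partial_matching n M (nats ?s ''mate'') (nats s ''matching'')" using pm by simp
      next
        fix t xs
        assume t: "unchanged ?W ?s t" "reals t ''cum'' = reals ?s ''cum''" "nats t ''w'' 0 = 0"
          and xs: "trail n M (nats ?s ''mate'') (nats t ''next'') xs (Suc ?u) 0"
        let ?t = "set_nat ''w'' 0 (Suc ?u) t"
        have ut: "unchanged (?W \<union> {''root'', ''w'', ''i''}) s ?t"
          using us t(1) by (simp add: unchanged_def)
        have eq: "nats t ''mate'' = ?m" "nats t ''matching'' = nats s ''matching''"
          "nats t ''size'' = nats s ''size''" "nats t ''free'' = ?g" "nats t ''i'' 0 = i"
          "nats t ''root'' 0 = Suc ?u"
          using t(1) by (simp_all add: unchanged_def)
        have "ert augment ?f8 ?t \<le> of_nat (1 + 6 * length xs) + (2 + ?K k')"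
        proof (rule ert_augment)
          show "partial_matching n M (nats ?t ''mate'') (nats ?t ''matching'')"
            using pm by (simp add: eq)
          show "nats ?t ''w'' 0 = Suc ?u" by simp
          show "?u \<in> free_rows n (nats ?t ''mate'')" using u by (simp add: eq)
          show "trail n M (nats ?t ''mate'') (nats ?t ''next'') xs (Suc ?u) 0"
            using xs by (simp add: eq)
        next
          fix r
          assume r: "unchanged {''u'', ''v'', ''w'', ''mate'', ''matching''} ?t r"
              "reals r = reals ?t" "partial_matching n M (nats r ''mate'') (nats r ''matching'')"
            and free: "free_rows n (nats r ''mate'') = free_rows n (nats ?t ''mate'') - {?u}"
          let ?A = "?W \<union> {''root'', ''w'', ''i'', ''mate'', ''matching''}"
          have ur: "unchanged ?A s r"
            using ut r(1) by (simp add: unchanged_def)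
          have eq': "nats r ''size'' 0 = Suc k'" "nats r ''free'' = ?g" "nats r ''i'' 0 = i"
            using r(1) size by (simp_all add: unchanged_def eq)
          let ?r = "set_nat ''free'' i (?g k') (set_nat ''size'' 0 k' r)"
          have "unchanged (?A \<union> {''size'', ''free''}) s ?r"
            by (intro unchanged_set_nat) (use ur in \<open>auto simp: unchanged_def\<close>)
          then have "sampling_input n M ?r"
            by (rule sampling_input_unchanged[OF inp]) (use t r in auto)
          moreover have "free_rows n (nats r ''mate'') = free_rows n ?m - {?u}"
            using free by (simp add: eq)
          ultimately have "prepared n M k' ?r"
            using r(3) swap_remove[OF inj, of i] i img eq' by (simp add: prepared_def k)
          then have "abstract_cost (prepared n M) ?K ?r \<le> ?K k'"
            by (rule abstract_cost_le) simp
          then have "1 + (1 + abstract_cost (prepared n M) ?K ?r) \<le> 1 + (1 + ?K k')"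
            by (intro add_left_mono)
          also have "\<dots> = 2 + ?K k'" by (simp flip: add.assoc)
          finally show "?f8 r \<le> 2 + ?K k'"
            by (simp add: eq')
        qed
        then have "1 + ert augment ?f8 ?t \<le> 1 + (of_nat (1 + 6 * length xs) + (2 + ?K k'))"
          by (rule add_left_mono)
        also have "\<dots> = of_nat (6 * length xs) + (1 + 1 + 2 + ?K k')"
          by (simp only: of_nat_add of_nat_1 ac_simps)
        also have "1 + 1 + 2 + ?K k' = 4 + ?K k'" by simp
        finally show "?f5 t \<le> of_nat (6 * length xs) + (4 + ?K k')"
          by (simp add: eq)
      qed (use u in auto)
      then have "1 + (1 + ert walk ?f5 ?s) \<le> 1 + (1 + (1 + ?c * ?H ?u + (4 + ?K k')))"
        by (intro add_left_mono) simp
      also have "\<dots> = 1 + 1 + 1 + 4 + ?K k' + ?c * ?H ?u"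
        by (simp only: ac_simps)
      also have "\<dots> = 7 + ?K k' + ?c * ?H ?u" by simp
      finally show ?thesis by simp
    qed
    have "(\<integral>\<^sup>+x. ?f1 (set_nat ''i'' 0 (nat \<lfloor>x * real k\<rfloor>) s) \<partial>uniform01)
      \<le> (\<Sum>i<k. ennreal (1 / k) * ?f1 (set_nat ''i'' 0 i s))"
      by (rule nn_integral_uniform01_nat_le) (simp add: k)
    also have "\<dots> \<le> (\<Sum>i<k. ennreal (1 / k) * (7 + ?K k' + ?c * ?H (?g i)))"
      by (intro sum_mono mult_left_mono round) auto
    also have "(\<Sum>i<k. ennreal (1 / k) * (X + ?c * ?H (?g i))) =
        (\<Sum>i<k. ennreal (1 / k)) * X + ?c * (ennreal (1 / k) * (\<Sum>i<k. ?H (?g i)))" for X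
      by (simp only: distrib_left sum.distrib sum_distrib_left sum_distrib_right mult.left_commute)
    also have "(\<Sum>i<k. ennreal (1 / k)) = 1"
      by (subst sum_ennreal) (simp_all add: k)
    \<comment> \<open>Here the average over indices becomes a sum over the free rows, to which
      \<open>sum_hitting_time_le\<close> applies.\<close>
    also have "(\<Sum>i<k. ?H (?g i)) = (\<Sum>u\<in>free_rows n ?m. ?H u)"
      using inj img by (simp add: k sum.reindex flip: img)
    also have "1 * (7 + ?K k') + ?c * (ennreal (1 / k) * (\<Sum>u\<in>free_rows n ?m. ?H u)) \<le>
        7 + ?K k' + ?c * (ennreal (1 / k) * of_nat n)"
      using sum_hitting_time_le[OF ds pm] by (simp add: add_left_mono mult_left_mono)
    also have "ennreal (1 / k) * of_nat n = ennreal (n / Suc k')"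
      by (simp add: k ennreal_of_nat_eq_real_of_nat flip: ennreal_mult'')
    finally have "1 + (1 + (\<integral>\<^sup>+x. ?f1 (set_nat ''i'' 0 (nat \<lfloor>x * real k\<rfloor>) s) \<partial>uniform01)) \<le>
        1 + (1 + (7 + ?K k' + ?c * ennreal (n / Suc k')))"
      by (intro add_left_mono)
    also have "\<dots> = ?K k' + (1 + 1 + 7 + ?c * ennreal (n / Suc k'))"
      by (simp only: ac_simps)
    also have "\<dots> = ?K k"
      by (simp add: k add.assoc)
    finally show "1 + ert (Nat_Draw ''i'' (Lit 0) (var ''size'') ;;
      assign ''w'' (Add (Nat_Cell ''free'' (var ''i'')) (Lit 1)) ;;
      assign ''root'' (var ''w'') ;;
      walk ;;
      assign ''w'' (var ''root'') ;;
      augment ;;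
      assign ''size'' (Sub (var ''size'') (Lit 1)) ;;
      Nat_Assign ''free'' (var ''i'') (Nat_Cell ''free'' (var ''size'')))
      (abstract_cost (prepared n M) ?K) s \<le> ?K k"
      using size by (simp add: k)
  next
    fix k s assume s: "prepared n M k s" and b: "\<not> bval (Less (Lit 0) (var ''size'')) s"
    then have k: "k = 0" by (auto simp: prepared_def)
    have "perfect_matching n M (\<lambda>u. if u < n then nats s ''matching'' u else u)"
      by (rule perfect_matchingI[of _ _ "nats s ''mate''"]) (use s k in \<open>auto simp: prepared_def\<close>)
    then have "matching_output n M s"
      unfolding matching_output_def by (intro exI conjI) auto
    then show "1 + ?f s \<le> ?K k" by simp
  qed
qed

section \<open>Preprocessing\<close>

definition fill_row :: com where
  "fill_row = While (Less (var ''k'') (Nat_Cell ''row_deg'' (var ''v'')))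
     (Real_Assign ''sum'' (Lit 0) (RAdd (Real_Cell ''sum'' (Lit 0))
        (Real_Cell ''row_adj'' (Add (Nat_Cell ''row_first'' (var ''v'')) (var ''k'')))) ;;
      Real_Assign ''cum'' (var ''p'') (Real_Cell ''sum'' (Lit 0)) ;;
      assign ''p'' (Add (var ''p'') (Lit 1)) ;;
      assign ''k'' (Add (var ''k'') (Lit 1)))"

text \<open>
  The rows get their own segments of \<open>cum\<close>, since nothing prevents their adjacency lists in the input
  from overlapping.
\<close>

definition prepare_rows :: com where
  "prepare_rows =
     assign ''v'' (Lit 0) ;;
     assign ''p'' (Lit 0) ;;
     assign ''size'' (var ''n'') ;;
     While (Less (var ''v'') (var ''n''))
       (Nat_Assign ''start'' (var ''v'') (var ''p'') ;;
        Real_Assign ''sum'' (Lit 0) (Of_Nat (Lit 0)) ;;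
        assign ''k'' (Lit 0) ;;
        fill_row ;;
        Nat_Assign ''mate'' (var ''v'') (Lit 0) ;;
        Nat_Assign ''free'' (var ''v'') (var ''v'') ;;
        assign ''v'' (Add (var ''v'') (Lit 1)))"

text \<open>\<open>p\<close> is the next unallocated cell of \<open>cum\<close>. The clause on
  \<open>q < p\<close> preserves the prefix sums of the rows treated before. An entry costs a test
  and four assignments.\<close>

lemma ert_fill_row:
  fixes w :: "nat \<Rightarrow> real"
  assumes s: "nats s ''k'' 0 = 0" "reals s ''sum'' 0 = 0" "nats s ''p'' 0 = p"
      "nats s ''row_deg'' (nats s ''v'' 0) = d"
      "\<And>i. reals s ''row_adj'' (nats s ''row_first'' (nats s ''v'' 0) + i) = w i"
    and f: "\<And>s'. unchanged {''k'', ''p''} s s' \<Longrightarrow> reals s' ''row_adj'' = reals s ''row_adj'' \<Longrightarrow>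
      nats s' ''p'' 0 = p + d \<Longrightarrow> \<forall>i<d. reals s' ''cum'' (p + i) = (\<Sum>j<Suc i. w j) \<Longrightarrow>
      \<forall>q<p. reals s' ''cum'' q = reals s ''cum'' q \<Longrightarrow> f s' \<le> B"
  shows "ert fill_row f s \<le> of_nat (1 + 5 * d) + B"
proof -
  define I where "I k s' \<longleftrightarrow> unchanged {''k'', ''p''} s s' \<and>
    reals s' ''row_adj'' = reals s ''row_adj'' \<and> k \<le> d \<and> nats s' ''k'' 0 = k \<and>
    nats s' ''p'' 0 = p + k \<and> reals s' ''sum'' 0 = (\<Sum>j<k. w j) \<and>
    (\<forall>i<k. reals s' ''cum'' (p + i) = (\<Sum>j<Suc i. w j)) \<and>
    (\<forall>q<p. reals s' ''cum'' q = reals s ''cum'' q)" for k s'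
  let ?K = "\<lambda>k. of_nat (1 + 5 * (d - k)) + B"
  have "ert fill_row f s \<le> ?K 0"
    unfolding fill_row_def
  proof (rule ert_While_le[where I = I and K = ?K])
    show "I 0 s" using s by (simp add: I_def)
  next
    fix k s' assume I: "I k s'"
      and b: "bval (Less (var ''k'') (Nat_Cell ''row_deg'' (var ''v''))) s'"
    have eq: "nats s' ''v'' = nats s ''v''" "nats s' ''row_deg'' = nats s ''row_deg''"
      "nats s' ''row_first'' = nats s ''row_first''"
      and us: "unchanged {''k'', ''p''} s s'"
      using I by (simp_all add: I_def unchanged_def)
    have k: "k < d" "nats s' ''k'' 0 = k" "nats s' ''p'' 0 = p + k"
      and sum: "reals s' ''sum'' 0 + w k = (\<Sum>j<Suc k. w j)"
      using I b s eq by (simp_all add: I_def)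
    have wk: "reals s' ''row_adj'' (nats s' ''row_first'' (nats s' ''v'' 0) + k) = w k"
      using I s(5) eq by (simp add: I_def)
    let ?t = "set_nat ''k'' 0 (Suc k) (set_nat ''p'' 0 (Suc (p + k))
      (set_real ''cum'' (p + k) (\<Sum>j<Suc k. w j) (set_real ''sum'' 0 (\<Sum>j<Suc k. w j) s')))"
    have "unchanged {''k'', ''p''} s ?t"
      by (intro unchanged_set_nat unchanged_set_real us) auto
    then have "I (Suc k) ?t"
      using I k unfolding I_def by (auto simp: less_Suc_eq)
    then have "abstract_cost I ?K ?t \<le> ?K (Suc k)"
      by (rule abstract_cost_le) simp
    then have "1 + (1 + (1 + (1 + (1 + abstract_cost I ?K ?t)))) \<le> 1 + (1 + (1 + (1 + (1 + ?K (Suc k)))))"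
      by (intro add_left_mono)
    also have "\<dots> = of_nat (5 + (1 + 5 * (d - Suc k))) + B"
      by (simp add: add.assoc)
    also have "5 + (1 + 5 * (d - Suc k)) = 1 + 5 * (d - k)"
      using k(1) by simp
    finally show "1 + ert (Real_Assign ''sum'' (Lit 0) (RAdd (Real_Cell ''sum'' (Lit 0))
        (Real_Cell ''row_adj'' (Add (Nat_Cell ''row_first'' (var ''v'')) (var ''k'')))) ;;
      Real_Assign ''cum'' (var ''p'') (Real_Cell ''sum'' (Lit 0)) ;;
      assign ''p'' (Add (var ''p'') (Lit 1)) ;;
      assign ''k'' (Add (var ''k'') (Lit 1))) (abstract_cost I ?K) s' \<le> ?K k"
      using k sum wk by simp
  next
    fix k s' assume I: "I k s'"
      and b: "\<not> bval (Less (var ''k'') (Nat_Cell ''row_deg'' (var ''v''))) s'"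
    have "nats s' ''v'' = nats s ''v''" "nats s' ''row_deg'' = nats s ''row_deg''"
      using I by (simp_all add: I_def unchanged_def)
    then have "k = d" using I b s by (simp add: I_def)
    then have "f s' \<le> B" using I by (intro f) (simp_all add: I_def)
    then show "1 + f s' \<le> ?K k"
      by (simp add: add.assoc add_left_mono add_increasing)
  qed
  then show ?thesis by simp
qed

lemma draw_free_prepare_rows: "draw_free prepare_rows"
  by (simp add: prepare_rows_def fill_row_def)

text \<open>A row costs \<open>8\<close> besides its entries: the outer test, the final test of
  \<open>fill_row\<close> and six assignments. The \<open>4\<close> covers three initial assignments
  and the last test. In the invariant, finished segments of \<open>cum\<close> lie below
  \<open>p\<close>, where later rows do not write.\<close>

lemma ert_prepare_rows:
  assumes inp: "sparse_input n M s"
  shows "ert prepare_rows (\<lambda>s. if prepared n M n s then 0 else \<infinity>) s \<le>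
    of_nat (4 + (\<Sum>u<n. 8 + 5 * nats s ''row_deg'' u))"
proof -
  let ?f = "\<lambda>s. if prepared n M n s then 0 else \<infinity> :: ennreal"
  define d where "d = nats s ''row_deg''"
  define w where "w u i = reals s ''row_adj'' (nats s ''row_first'' u + i)" for u i
  let ?A = "{''v'', ''p'', ''k'', ''size'', ''start'', ''mate'', ''free''}"
  define I where "I v s' \<longleftrightarrow> unchanged ?A s s' \<and> reals s' ''row_adj'' = reals s ''row_adj'' \<and>
    v \<le> n \<and> nats s' ''v'' 0 = v \<and> nats s' ''size'' 0 = n \<and>
    (\<forall>u<v. nats s' ''start'' u + d u \<le> nats s' ''p'' 0 \<and> nats s' ''mate'' u = 0 \<and>
      nats s' ''free'' u = u \<and>
      (\<forall>i<d u. reals s' ''cum'' (nats s' ''start'' u + i) = (\<Sum>j<Suc i. w u j)))" for v s'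
  let ?K = "\<lambda>v. of_nat (1 + (\<Sum>u=v..<n. 8 + 5 * d u)) :: ennreal"
  have n: "nats s ''n'' 0 = n" using inp by (simp add: sparse_input_def)
  let ?s = "set_nat ''size'' 0 n (set_nat ''p'' 0 0 (set_nat ''v'' 0 0 s))"
  let ?body = "Nat_Assign ''start'' (var ''v'') (var ''p'') ;;
        Real_Assign ''sum'' (Lit 0) (Of_Nat (Lit 0)) ;;
        assign ''k'' (Lit 0) ;;
        fill_row ;;
        Nat_Assign ''mate'' (var ''v'') (Lit 0) ;;
        Nat_Assign ''free'' (var ''v'') (var ''v'') ;;
        assign ''v'' (Add (var ''v'') (Lit 1))"
  have "ert (While (Less (var ''v'') (var ''n'')) ?body) ?f ?s \<le> ?K 0"
  proof (rule ert_While_le[where I = I and K = ?K])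
    have "unchanged ?A s ?s" by (intro unchanged_set_nat) auto
    then show "I 0 ?s" by (simp add: I_def)
  next
    fix v s' assume I: "I v s'" and b: "bval (Less (var ''v'') (var ''n'')) s'"
    have us: "unchanged ?A s s'" and v: "nats s' ''v'' 0 = v"
      and eq: "nats s' ''n'' 0 = n" "nats s' ''row_deg'' = d" "nats s' ''row_first'' = nats s ''row_first''"
      using I n by (simp_all add: I_def unchanged_def d_def)
    have vn: "v < n" using I b eq v by (simp add: I_def)
    let ?p = "nats s' ''p'' 0"
    let ?t = "set_nat ''k'' 0 0 (set_real ''sum'' 0 0 (set_nat ''start'' v ?p s'))"
    let ?g = "ert (Nat_Assign ''mate'' (var ''v'') (Lit 0) ;;
        Nat_Assign ''free'' (var ''v'') (var ''v'') ;;
        assign ''v'' (Add (var ''v'') (Lit 1))) (abstract_cost I ?K)"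
    have "ert fill_row ?g ?t \<le> of_nat (1 + 5 * d v) + (3 + ?K (Suc v))"
    proof (rule ert_fill_row[where w = "w v"])
      fix r assume r: "unchanged {''k'', ''p''} ?t r" "reals r ''row_adj'' = reals ?t ''row_adj''"
        "nats r ''p'' 0 = ?p + d v" "\<forall>i<d v. reals r ''cum'' (?p + i) = (\<Sum>j<Suc i. w v j)"
        "\<forall>q<?p. reals r ''cum'' q = reals ?t ''cum'' q"
      have ur: "unchanged ?A s r" using us r(1) by (simp add: unchanged_def)
      have eq': "nats r ''v'' 0 = v" "nats r ''start'' = (nats s' ''start'')(v := ?p)"
        "nats r ''mate'' = nats s' ''mate''" "nats r ''free'' = nats s' ''free''"
        "nats r ''size'' = nats s' ''size''"
        using r(1) v by (simp_all add: unchanged_def)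
      let ?r = "set_nat ''v'' 0 (Suc v) (set_nat ''free'' v v (set_nat ''mate'' v 0 r))"
      have "I (Suc v) ?r"
        unfolding I_def
      proof (intro conjI allI impI)
        show "unchanged ?A s ?r" by (intro unchanged_set_nat ur) auto
        fix u assume u: "u < Suc v"
        show "nats ?r ''start'' u + d u \<le> nats ?r ''p'' 0"
          using u I r(3) by (cases "u = v") (auto simp: I_def eq' less_Suc_eq intro: trans_le_add1)
        show "nats ?r ''mate'' u = 0" "nats ?r ''free'' u = u"
          using u I by (auto simp: I_def eq' less_Suc_eq)
        fix i assume i: "i < d u"
        show "reals ?r ''cum'' (nats ?r ''start'' u + i) = (\<Sum>j<Suc i. w u j)"
        proof (cases "u = v")
          case True
          then show ?thesis using r(4) i by (simp add: eq')
        next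
          case False
          then have "u < v" using u by simp
          then have "nats s' ''start'' u + d u \<le> ?p"
            "reals s' ''cum'' (nats s' ''start'' u + i) = (\<Sum>j<Suc i. w u j)"
            using I i by (simp_all add: I_def)
          then show ?thesis using r(5) i False by (simp add: eq')
        qed
      qed (use I r(2) vn in \<open>auto simp: I_def eq'\<close>)
      then have "abstract_cost I ?K ?r \<le> ?K (Suc v)"
        by (rule abstract_cost_le) simp
      then have "1 + (1 + (1 + abstract_cost I ?K ?r)) \<le> 1 + (1 + (1 + ?K (Suc v)))"
        by (intro add_left_mono)
      also have "\<dots> = 3 + ?K (Suc v)" by (simp flip: add.assoc)
      finally show "?g r \<le> 3 + ?K (Suc v)" by (simp add: eq')
    qed (use v eq I in \<open>auto simp: w_def I_def\<close>)
    then have "1 + (1 + (1 + (1 + ert fill_row ?g ?t))) \<le>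
        1 + (1 + (1 + (1 + (of_nat (1 + 5 * d v) + (3 + ?K (Suc v))))))"
      by (intro add_left_mono)
    also have "\<dots> = of_nat (4 + (1 + 5 * d v) + (3 + (1 + (\<Sum>u=Suc v..<n. 8 + 5 * d u))))"
      by (simp add: add.assoc)
    also have "4 + (1 + 5 * d v) + (3 + (1 + (\<Sum>u=Suc v..<n. 8 + 5 * d u)))
        = 1 + (\<Sum>u=v..<n. 8 + 5 * d u)"
      using vn by (subst (2) sum.atLeast_Suc_lessThan) auto
    finally show "1 + ert ?body (abstract_cost I ?K) s' \<le> ?K v"
      using v by simp
  next
    fix v s' assume I: "I v s'" and b: "\<not> bval (Less (var ''v'') (var ''n'')) s'"
    have us: "unchanged ?A s s'"
      and eq: "nats s' ''n'' 0 = n" "nats s' ''row_deg'' = d" "nats s' ''row_first'' = nats s ''row_first''"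
        "nats s' ''row_adj'' = nats s ''row_adj''"
      using I n by (simp_all add: I_def unchanged_def d_def)
    have vn: "v = n" using I b eq by (simp add: I_def)
    have "sampling_input n M s'"
      unfolding sampling_input_def Let_def
    proof (intro allI impI conjI)
      fix u assume u: "u < n"
      let ?e = "\<lambda>k. nats s ''row_adj'' (nats s ''row_first'' u + k)"
      have adj: "bij_betw ?e {..<d u} {v. v < n \<and> M $$ (u, v) \<noteq> 0}"
        "\<And>k. k < d u \<Longrightarrow> w u k = M $$ (u, ?e k)"
        using inp u by (auto simp: sparse_input_def adjacency_arrays_def Let_def w_def d_def)
      then show "bij_betw (\<lambda>k. nats s' ''row_adj'' (nats s' ''row_first'' u + k))
          {..<nats s' ''row_deg'' u} {v. v < n \<and> M $$ (u, v) \<noteq> 0}"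
        by (simp add: eq)
      fix k assume k: "k < nats s' ''row_deg'' u"
      have "reals s' ''cum'' (nats s' ''start'' u + k) = (\<Sum>i<Suc k. w u i)"
        using I k u by (simp add: I_def eq vn)
      also have "\<dots> = (\<Sum>i<Suc k. M $$ (u, ?e i))"
        using k by (intro sum.cong refl adj(2)) (simp add: eq)
      finally show "reals s' ''cum'' (nats s' ''start'' u + k) =
          (\<Sum>i<Suc k. M $$ (u, nats s' ''row_adj'' (nats s' ''row_first'' u + i)))"
        by (simp only: eq)
    qed
    moreover have "free_rows n (nats s' ''mate'') = {..<n}"
      using I by (auto simp: free_rows_def I_def vn)
    \<comment> \<open>All columns are free, so this holds vacuously, whatever
      \<open>matching\<close> contains at the start.\<close>
    moreover have "partial_matching n M (nats s' ''mate'') (nats s' ''matching'')"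
      using I by (auto simp: partial_matching_def I_def vn)
    moreover have "inj_on (nats s' ''free'') {..<n}" "nats s' ''free'' ` {..<n} = {..<n}"
      using I by (auto simp: I_def vn inj_on_def)
    ultimately have "prepared n M n s'"
      using I by (simp add: prepared_def I_def)
    then show "1 + ?f s' \<le> ?K v" by simp
  qed
  then have "1 + (1 + (1 + ert (While (Less (var ''v'') (var ''n'')) ?body) ?f ?s)) \<le>
      1 + (1 + (1 + ?K 0))"
    by (intro add_left_mono)
  also have "\<dots> = of_nat (3 + (1 + (\<Sum>u=0..<n. 8 + 5 * d u)))"
    by (simp add: add.assoc)
  finally show ?thesis
    using n by (simp add: prepare_rows_def d_def lessThan_atLeast0 del: of_nat_add)
qed

section \<open>Size of the support, almost sure correctness, and the constants\<close>

lemma card_support: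
  assumes ds: "doubly_stochastic n M" and inp: "sparse_input n M s"
  shows "card (support n M) = (\<Sum>u<n. nats s ''row_deg'' u)" and "n \<le> card (support n M)"
proof -
  let ?R = "\<lambda>u. {v. v < n \<and> M $$ (u, v) \<noteq> 0}"
  have card: "card (?R u) = nats s ''row_deg'' u" if "u < n" for u
  proof -
    have "bij_betw (\<lambda>k. nats s ''row_adj'' (nats s ''row_first'' u + k)) {..<nats s ''row_deg'' u} (?R u)"
      using inp that by (simp add: sparse_input_def adjacency_arrays_def Let_def)
    from bij_betw_same_card[OF this] show ?thesis by simp
  qed
  have "support n M = (SIGMA u:{..<n}. ?R u)"
    by (auto simp: support_def)
  then have "card (support n M) = (\<Sum>u<n. card (?R u))"
    by (simp add: card_SigmaI)
  then show eq: "card (support n M) = (\<Sum>u<n. nats s ''row_deg'' u)"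
    by (simp add: card)
  \<comment> \<open>A row summing to \<open>1\<close> has a non-zero entry. Thus the number of
    entries dominates \<open>n\<close> and absorbs the preprocessing cost per row.\<close>
  have "1 \<le> nats s ''row_deg'' u" if "u < n" for u
  proof (rule ccontr)
    assume "\<not> 1 \<le> nats s ''row_deg'' u"
    then have "card (?R u) = 0" using card[OF that] by linarith
    then have "?R u = {}" by simp
    then have "(\<Sum>v<n. M $$ (u, v)) = 0" by (intro sum.neutral) auto
    then show False using ds that by (simp add: doubly_stochastic_def)
  qed
  then have "(\<Sum>u<n. 1) \<le> (\<Sum>u<n. nats s ''row_deg'' u)"
    by (intro sum_mono) auto
  then show "n \<le> card (support n M)" by (simp add: eq)
qed

text \<open>A finite expectation is finite almost everywhere. As divergence costs an infinite time
  and a violated \<open>P\<close> an infinite penalty, both have probability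
  \<open>0\<close>.\<close>

lemma ert_post_sound:
  assumes P: "Measurable.pred config_space (\<lambda>x. P (fst x))"
    and B: "ert c (\<lambda>s. if P s then 0 else \<infinity>) s \<le> ennreal B"
  shows "AE \<omega> in coins. \<exists>t y. exec c (s, \<omega>) t y \<and> P (fst y)"
    and "(\<integral>\<^sup>+\<omega>. time c (s, \<omega>) \<partial>coins) \<le> ennreal B"
proof -
  interpret coins: prob_space coins by (rule prob_space_coins)
  let ?g = "\<lambda>x. if P (fst x) then 0 else \<infinity> :: ennreal"
  have g: "?g \<in> borel_measurable config_space"
    using P by measurable
  have "(\<lambda>s. \<integral>\<^sup>+\<omega>. ?g (s, \<omega>) \<partial>coins) = (\<lambda>s. if P s then 0 else \<infinity>)"
    by (auto simp: coins.emeasure_space_1)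
  with nn_integral_time_run_le_ert[OF g, of c s] B
  have le: "(\<integral>\<^sup>+\<omega>. time c (s, \<omega>) + ?g (run c (s, \<omega>)) \<partial>coins) \<le> ennreal B"
    by simp
  have "(\<integral>\<^sup>+\<omega>. time c (s, \<omega>) \<partial>coins) \<le> (\<integral>\<^sup>+\<omega>. time c (s, \<omega>) + ?g (run c (s, \<omega>)) \<partial>coins)"
    by (intro nn_integral_mono) (simp add: add_increasing2)
  with le show "(\<integral>\<^sup>+\<omega>. time c (s, \<omega>) \<partial>coins) \<le> ennreal B" by (rule order_trans[rotated])
  have "AE \<omega> in coins. time c (s, \<omega>) + ?g (run c (s, \<omega>)) \<noteq> \<infinity>"
  proof (rule nn_integral_PInf_AE)
    show "(\<lambda>\<omega>. time c (s, \<omega>) + ?g (run c (s, \<omega>))) \<in> borel_measurable coins"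
      by (rule measurable_compose[OF coins_to_config measurable_time_run[OF g]])
    show "(\<integral>\<^sup>+\<omega>. time c (s, \<omega>) + ?g (run c (s, \<omega>)) \<partial>coins) \<noteq> \<infinity>"
      using le by (auto simp: top_unique)
  qed
  then show "AE \<omega> in coins. \<exists>t y. exec c (s, \<omega>) t y \<and> P (fst y)"
  proof eventually_elim
    case (elim \<omega>)
    then obtain t y where "exec c (s, \<omega>) t y" using time_infinite[of c "(s, \<omega>)"] by auto
    moreover from this have "P (fst y)" using elim by (auto simp: run_eq split: if_splits)
    ultimately show ?case by blast
  qed
qed

text \<open>The existential quantifier ranges over functions, but only finitely many of them are
  permutations of the rows.\<close>

lemma matching_output_measurable: "Measurable.pred config_space (\<lambda>x. matching_output n M (fst x))"
proof -
  note config_coordinates(1) [measurable]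
  have "{\<sigma>. perfect_matching n M \<sigma>} \<subseteq> {\<sigma>. \<sigma> permutes {..<n}}"
    by (auto simp: perfect_matching_def)
  then have fin: "finite {\<sigma>. perfect_matching n M \<sigma>}"
    by (rule finite_subset) (simp add: finite_permutations)
  have "Measurable.pred config_space
      (\<lambda>x. \<exists>\<sigma>\<in>{\<sigma>. perfect_matching n M \<sigma>}. \<forall>i\<in>{..<n}. nats (fst x) ''matching'' i = \<sigma> i)"
    by (intro pred_intros_finite fin finite_lessThan) measurable
  then show ?thesis
    by (simp add: matching_output_def Bex_def Ball_def)
qed

lemma find_matching_bound:
  assumes n: "1 \<le> n"
  shows "\<exists>L. n \<le> 2 ^ L \<and> 1 + (\<Sum>j<n. 9 + of_nat (15 + 4 * L) * ennreal (n / Suc j))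
    \<le> ennreal (60 * max 1 (real n * (log 2 (real n))\<^sup>2))"
proof -
  define l where "l = log 2 (real n)"
  define L where "L = nat \<lceil>l\<rceil>"
  have l: "0 \<le> l" using n by (simp add: l_def)
  have L: "l \<le> real L" "real L \<le> l + 1" using l by (auto simp: L_def)
  have "real n = 2 powr l" using n by (simp add: l_def)
  also have "\<dots> \<le> 2 powr real L" using L by simp
  finally have "real n \<le> 2 ^ L" by (simp add: powr_realpow)
  then have nL: "n \<le> 2 ^ L" by (metis numeral_power_le_of_nat_cancel_iff of_nat_le_iff of_nat_numeral of_nat_power)
  \<comment> \<open>The difference between the harmonic number and the logarithm decreases, so it is
    at most its value \<open>1\<close> at \<open>n = 1\<close>.\<close>
  have "harm n - ln (real n) \<le> harm 1 - ln (real 1)"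
    using n by (intro euler_mascheroni_sequence_decreasing) auto
  then have "harm n \<le> 1 + ln (real n)" by (simp add: harm_def)
  also have "ln (real n) \<le> l"
  proof -
    have "ln 2 \<le> (1 :: real)" using ln_le_minus_one[of 2] by simp
    then have "ln (real n) * ln 2 \<le> ln (real n) * 1" using n by (intro mult_left_mono) auto
    then show ?thesis by (simp add: l_def log_def field_simps)
  qed
  finally have H: "harm n \<le> 1 + l" by simp
  have "1 + (\<Sum>j<n. 9 + of_nat (15 + 4 * L) * ennreal (n / Suc j)) =
      ennreal (1 + (\<Sum>j<n. 9 + real (15 + 4 * L) * (n / Suc j)))"
  proof -
    have summand: "9 + of_nat c * ennreal x = ennreal (9 + real c * x)" if "0 \<le> x" for c and x :: real
      using that by (simp add: ennreal_of_nat_eq_real_of_nat ennreal_mult)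
    have "9 + of_nat (15 + 4 * L) * ennreal (n / Suc j) = ennreal (9 + real (15 + 4 * L) * (n / Suc j))" for j
      by (rule summand) simp
    then have "1 + (\<Sum>j<n. 9 + of_nat (15 + 4 * L) * ennreal (n / Suc j)) =
        1 + (\<Sum>j<n. ennreal (9 + real (15 + 4 * L) * (n / Suc j)))"
      by (simp only:)
    also have "\<dots> = ennreal 1 + ennreal (\<Sum>j<n. 9 + real (15 + 4 * L) * (n / Suc j))"
      by (subst sum_ennreal) auto
    also have "\<dots> = ennreal (1 + (\<Sum>j<n. 9 + real (15 + 4 * L) * (n / Suc j)))"
      by (intro ennreal_plus[symmetric] sum_nonneg) auto
    finally show ?thesis .
  qed
  also have "(\<Sum>j<n. 9 + real (15 + 4 * L) * (n / Suc j)) = 9 * n + real (15 + 4 * L) * (n * harm n)"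
    by (simp only: harm_def One_nat_def sum.atLeast1_atMost_eq sum.distrib sum_distrib_left) (simp add: divide_inverse mult.assoc)
  also have "ennreal (1 + (9 * n + real (15 + 4 * L) * (n * harm n))) \<le> ennreal (60 * max 1 (n * l\<^sup>2))"
  proof (rule ennreal_leI)
    have "1 + (9 * n + real (15 + 4 * L) * (n * harm n)) \<le> 1 + (9 * n + (19 + 4 * l) * (n * (1 + l)))"
      using L H l harm_nonneg[where ?'a = real] by (intro add_left_mono mult_mono) auto
    also have "\<dots> \<le> 60 * max 1 (n * l\<^sup>2)"
    \<comment> \<open>For \<open>n = 1\<close> the logarithm vanishes and the left side is
      \<open>29\<close>, which only the maximum with \<open>1\<close> can bound. For larger
      \<open>n\<close> we have \<open>1 \<le> l\<close>, every term is at most a multiple of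
      \<open>n * l\<^sup>2\<close>, and the coefficients add up to \<open>56\<close>.\<close>
    proof (cases "n = 1")
      case True
      then show ?thesis by (simp add: l_def)
    next
      case False
      then have "log 2 2 \<le> l" using n unfolding l_def by (intro log_mono) auto
      then have l1: "1 \<le> l" by simp
      have l2: "l \<le> l\<^sup>2" "1 \<le> l\<^sup>2" using l1 by (auto simp: power2_eq_square intro: order_trans)
      have "1 + (9 * n + (19 + 4 * l) * (n * (1 + l))) = 1 + n * (28 + 23 * l + 4 * l\<^sup>2)"
        by (simp add: algebra_simps power2_eq_square)
      also have "\<dots> \<le> real n * 1 + n * (28 * l\<^sup>2 + 23 * l\<^sup>2 + 4 * l\<^sup>2)"
        using l2 n by (intro add_mono mult_left_mono) auto
      also have "\<dots> \<le> n * l\<^sup>2 + n * (28 * l\<^sup>2 + 23 * l\<^sup>2 + 4 * l\<^sup>2)"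
        using l2 by (intro add_right_mono mult_left_mono) auto
      also have "\<dots> = 56 * (n * l\<^sup>2)" by (simp add: algebra_simps)
      also have "\<dots> \<le> 60 * max 1 (n * l\<^sup>2)"
        by (intro mult_mono) auto
      finally show ?thesis .
    qed
    finally show "1 + (9 * n + real (15 + 4 * L) * (n * harm n)) \<le> 60 * max 1 (n * l\<^sup>2)" .
  qed
  finally show ?thesis using nL unfolding l_def by blast
qed

theorem theorem3:
  shows "\<exists>(preprocess :: com) (find :: com) (C :: real). \<forall>(n :: nat) (M :: real mat) (s :: memory).
    1 \<le> n \<longrightarrow> doubly_stochastic n M \<longrightarrow> sparse_input n M s \<longrightarrow>
      (\<forall>\<omega>\<in>streams {0..<1}. halts_within (C * real (card (support n M))) preprocess (s, \<omega>)) \<and>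
      (AE \<omega> in coins. \<exists>t y. exec find (run preprocess (s, \<omega>)) t y \<and> matching_output n M (fst y)) \<and>
      (\<integral>\<^sup>+\<omega>. time find (run preprocess (s, \<omega>)) \<partial>coins)
        \<le> ennreal (C * max 1 (real n * (log 2 (real n))\<^sup>2))"
proof (rule exI[of _ prepare_rows], rule exI[of _ find_matching], rule exI[of _ 60], intro allI impI)
  fix n :: nat and M :: "real mat" and s :: memory
  assume n: "1 \<le> n" and ds: "doubly_stochastic n M" and inp: "sparse_input n M s"
  let ?B = "4 + (\<Sum>u<n. 8 + 5 * nats s ''row_deg'' u)"
  note pre = ert_prepare_rows[OF inp]
  also have "of_nat ?B < (\<infinity> :: ennreal)" by (simp add: of_nat_less_top del: of_nat_add)
  \<comment> \<open>The memory \<open>s'\<close> is the same for every stream and the stream is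
    untouched, so the expectation for \<open>find_matching\<close> is over fresh coins from one
    fixed memory.\<close>
  finally obtain t s' where t: "\<And>\<omega>. exec prepare_rows (s, \<omega>) t (s', \<omega>)"
    and le: "of_nat t + (if prepared n M n s' then 0 else \<infinity>) \<le>
      ert prepare_rows (\<lambda>s. if prepared n M n s then 0 else \<infinity>) s"
    using draw_free_ert[OF draw_free_prepare_rows] by blast
  from le pre have "of_nat t + (if prepared n M n s' then 0 else \<infinity>) \<le> (of_nat ?B :: ennreal)"
    by (rule order_trans)
  then have prep: "prepared n M n s'" and "t \<le> ?B"
    by (auto split: if_splits simp: top_unique simp del: of_nat_add)
  \<comment> \<open>With \<open>m\<close> the size of the support, \<open>4 + 8 * n + 5 * m\<close>
    is at most \<open>17 * m\<close>, as \<open>1 \<le> n\<close> and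
    \<open>n \<le> m\<close>.\<close>
  then have "t \<le> 60 * card (support n M)"
    using card_support[OF ds inp] n by (simp add: sum.distrib flip: sum_distrib_left)
  then have "real t \<le> 60 * real (card (support n M))"
    by (metis of_nat_le_iff of_nat_mult of_nat_numeral)
  then have halts: "halts_within (60 * real (card (support n M))) prepare_rows (s, \<omega>)" for \<omega>
    unfolding halts_within_def using t by blast
  obtain L where L: "n \<le> 2 ^ L" "1 + (\<Sum>j<n. 9 + of_nat (15 + 4 * L) * ennreal (n / Suc j))
      \<le> ennreal (60 * max 1 (real n * (log 2 (real n))\<^sup>2))"
    using find_matching_bound[OF n] by blast
  have "ert find_matching (\<lambda>s. if matching_output n M s then 0 else \<infinity>) s'
      \<le> ennreal (60 * max 1 (real n * (log 2 (real n))\<^sup>2))"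
    using ert_find_matching[OF ds L(1) prep] L(2) by (rule order_trans)
  from ert_post_sound[OF matching_output_measurable this] halts
  show "(\<forall>\<omega>\<in>streams {0..<1}. halts_within (60 * real (card (support n M))) prepare_rows (s, \<omega>)) \<and>
      (AE \<omega> in coins. \<exists>t y. exec find_matching (run prepare_rows (s, \<omega>)) t y \<and> matching_output n M (fst y)) \<and>
      (\<integral>\<^sup>+\<omega>. time find_matching (run prepare_rows (s, \<omega>)) \<partial>coins)
        \<le> ennreal (60 * max 1 (real n * (log 2 (real n))\<^sup>2))"
    by (simp add: run_eq[OF t])
qed

end
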